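(* Let $W$ be a Weyl group acting on the Euclidean space $E_n=\mathbb R^n$, with dominant Weyl chamber $D_+$. Consider the usual Fourier transforms on $\mathbb R^n$, $$\tilde f(\lambda)=\int_{\mathbb R^n}f(x)e^{2\pi \mathrm{i}\langle\lambda,x\rangle}dx,\qquad f(x)=\int_{\mathbb R^n}\tilde f(\lambda)e^{-2\pi \mathrm{i}\langle\lambda,x\rangle}d\lambda,$$ and let the function $f$ be invariant with respect to $W$, i.e. $f(wx)=f(x)$ for $w\in W$. Then $\tilde f$ is also $W$-invariant, and $$\tilde f(\lambda)=\int_{D_+}f(x)\,\hat\phi_\lambda(x)\,dx,\qquad f(x)=\int_{D_+}\tilde f(\lambda)\,\overline{\hat\phi_\lambda(x)}\,d\lambda,$$ where $\hat\phi_\lambda(x)=\sum_{w\in W}e^{2\pi \mathrm{i}\langle w\lambda,x\rangle}$. For these transforms the Plancherel formula $$\int_{D_+}|f(x)|^2dx=\int_{D_+}|\tilde f(\lambda)|^2d\lambda$$ holds.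
   Context: $W$ is the Weyl group of a root system spanning $E_n$ with simple roots $\alpha_1,\dots,\alpha_n$; it is generated by the reflections $r_ix=x-\frac{2\langle x,\alpha_i\rangle}{\langle\alpha_i,\alpha_i\rangle}\alpha_i$, where $\langle\cdot,\cdot\rangle$ is the scalar product on $E_n$. The dominant Weyl chamber is $D_+=\{x\in E_n:\langle x,\alpha_i\rangle\ge0,\ i=1,\dots,n\}$. The functions $\hat\phi_\lambda$, $\lambda\in E_n$, are called modified orbit functions. $dx$ and $d\lambda$ denote the Euclidean measure. *)

theory Defs
  imports "HOL-Analysis.Analysis"
begin

definition reflection :: "real ^ 'n \<Rightarrow> real ^ 'n \<Rightarrow> real ^ 'n" where
  "reflection a x = x - (2 * (x \<bullet> a) / (a \<bullet> a)) *\<^sub>R a"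

(* Crystallographic root systems. Reducedness (only multiples a and -a of a root a are roots)
   is not required, so the non-reduced types are covered as well. *)
definition root_system :: "(real ^ 'n) set \<Rightarrow> bool" where
  "root_system R \<longleftrightarrow>
     finite R \<and> 0 \<notin> R \<and> span R = UNIV \<and>
     (\<forall>a\<in>R. \<forall>b\<in>R. reflection a b \<in> R) \<and>
     (\<forall>a\<in>R. \<forall>b\<in>R. 2 * (b \<bullet> a) / (a \<bullet> a) \<in> \<int>)"

(* The simple roots are indexed by the coordinate type, since the rank equals the dimension. *)
definition simple_roots :: "(real ^ 'n) set \<Rightarrow> ('n \<Rightarrow> real ^ 'n) \<Rightarrow> bool" where
  "simple_roots R \<alpha> \<longleftrightarrow>
     range \<alpha> \<subseteq> R \<and> inj \<alpha> \<and> independent (range \<alpha>) \<and>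
     (\<forall>b\<in>R. \<exists>c :: 'n \<Rightarrow> int.
        b = (\<Sum>i\<in>UNIV. real_of_int (c i) *\<^sub>R \<alpha> i) \<and> ((\<forall>i. 0 \<le> c i) \<or> (\<forall>i. c i \<le> 0)))"

(* Reflections are involutions, so closing under left multiplication by the generators
   already yields a group. *)
inductive_set weyl_group :: "('n \<Rightarrow> real ^ 'n) \<Rightarrow> (real ^ 'n \<Rightarrow> real ^ 'n) set"
  for \<alpha> :: "'n \<Rightarrow> real ^ 'n" where
  id: "id \<in> weyl_group \<alpha>"
| reflection: "w \<in> weyl_group \<alpha> \<Longrightarrow> reflection (\<alpha> i) \<circ> w \<in> weyl_group \<alpha>"

definition dominant_chamber :: "('n \<Rightarrow> real ^ 'n) \<Rightarrow> (real ^ 'n) set" where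
  "dominant_chamber \<alpha> = {x. \<forall>i. 0 \<le> x \<bullet> \<alpha> i}"

definition modified_orbit_function ::
    "('n \<Rightarrow> real ^ 'n) \<Rightarrow> real ^ 'n \<Rightarrow> real ^ 'n \<Rightarrow> complex" where
  "modified_orbit_function \<alpha> l x =
     (\<Sum>w\<in>weyl_group \<alpha>. exp (2 * complex_of_real pi * \<i> * complex_of_real (w l \<bullet> x)))"

definition fourier_transform :: "(real ^ 'n \<Rightarrow> complex) \<Rightarrow> real ^ 'n \<Rightarrow> complex" where
  "fourier_transform f l =
     (LINT x|lebesgue. f x * exp (2 * complex_of_real pi * \<i> * complex_of_real (l \<bullet> x)))"

definition inverse_fourier_transform :: "(real ^ 'n \<Rightarrow> complex) \<Rightarrow> real ^ 'n \<Rightarrow> complex" where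
  "inverse_fourier_transform g x =
     (LINT l|lebesgue. g l * exp (- (2 * complex_of_real pi * \<i> * complex_of_real (l \<bullet> x))))"

end

theory Submission
  imports Defs "HOL-Probability.Characteristic_Functions"
begin

text \<open>The Weyl group acts by orthogonal maps, and every point off finitely many hyperplanes lies in
  exactly one translate of the dominant chamber: maximising \<open>w x \<bullet> \<rho>\<close> for a strictly dominant \<open>\<rho>\<close>
  moves \<open>x\<close> into the chamber, and the exchange condition gives uniqueness. Hence an integral over the
  whole space is the sum over the group of integrals over the chamber, which folds the exponential
  kernel of the Fourier transform into the orbit function and reduces everything to Fourier inversion
  and Plancherel on the whole space. Both of these follow by damping the transform with a Gaussian,
  whose effect on the original function is a convolution with an approximate identity.\<close>

subsection \<open>Orthogonal invariance of Lebesgue measure\<close>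

text \<open>The obstacle is that Gaussian smoothings converge pointwise only for bounded continuous
  functions, while \<open>f\<close> is merely integrable. In the limit arguments the smoothing is
  therefore put on a continuous test function, by symmetry of the kernel, and information on
  \<open>f\<close> is recovered from the pairings. For inversion this gives equality almost
  everywhere, which improves to equality at each point of continuity of \<open>f\<close> because a
  Fourier transform is continuous. For Plancherel the two inequalities have different sources: one
  is Fatou's lemma, the other a polarised bound that is linear in \<open>f\<close>, so smoothings of
  \<open>f\<close> never have to converge in square mean. In the Plancherel formula the order of the
  group appears as a factor on both sides and cancels; in the two transforms the sum over the group
  is absorbed into the orbit function.\<close>

lemma nn_integral_lborel_translation:
  fixes f :: "'a::euclidean_space \<Rightarrow> ennreal"
  assumes [measurable]: "f \<in> borel_measurable borel"
  shows "(\<integral>\<^sup>+x. f (c + x) \<partial>lborel) = (\<integral>\<^sup>+x. f x \<partial>lborel)"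
proof -
  have "(\<integral>\<^sup>+x. f x \<partial>lborel) = (\<integral>\<^sup>+x. f x \<partial>distr lborel borel ((+) c))"
    by (simp add: lborel_distr_plus)
  also have "\<dots> = (\<integral>\<^sup>+x. f (c + x) \<partial>lborel)"
    by (subst nn_integral_distr) auto
  finally show ?thesis ..
qed

text \<open>The Fubini argument for uniqueness of Haar measure: for a unit ball \<open>B\<close>, evaluating
  \<open>\<integral>\<integral> 1\<^sub>B(y) 1\<^sub>A(T x + y)\<close> in both orders compares the image measure of \<open>A\<close> with its Lebesgue
  measure, and the constant is 1 because \<open>T\<close> preserves balls.\<close>

lemma lborel_distr_orthogonal:
  fixes T :: "'a::euclidean_space \<Rightarrow> 'a"
  assumes T: "orthogonal_transformation T"
  shows "distr lborel borel T = lborel"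
proof (rule measure_eqI)
  show "sets (distr lborel borel T) = sets lborel" by simp
next
  fix A assume "A \<in> sets (distr lborel borel T)"
  then have A[measurable]: "A \<in> sets borel" by simp
  have lin: "linear T" using T by (simp add: orthogonal_transformation_def)
  have contT: "continuous_on UNIV T" using lin by (simp add: linear_continuous_on linear_conv_bounded_linear)
  have [measurable]: "T \<in> borel \<rightarrow>\<^sub>M borel" using contT by (rule borel_measurable_continuous_onI)
  define B where "B = ball (0::'a) 1"
  have B[measurable]: "B \<in> sets borel" by (simp add: B_def)
  obtain S where S: "orthogonal_transformation S" "\<And>x. T (S x) = x" "\<And>x. S (T x) = x"
    using orthogonal_transformation_inv[OF T] orthogonal_transformation_inj[OF T] orthogonal_transformation_surj[OF T]
    by (metis inv_f_f surj_f_inv_f)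
  define c where "c = emeasure lborel B"
  have c_fin: "c \<noteq> \<infinity>" "c \<noteq> 0"
  proof -
    show "c \<noteq> \<infinity>" unfolding c_def B_def using emeasure_lborel_ball_finite[of "0::'a" 1] by auto
    have "\<not> negligible B" unfolding B_def by (rule open_not_negligible) auto
    then have "B \<notin> null_sets lborel"
      using null_sets_completionI[of B lborel] by (auto simp: negligible_iff_null_sets)
    then show "c \<noteq> 0" unfolding c_def by (simp add: null_sets_def)
  qed
  have shift: "(\<integral>\<^sup>+x. indicator A (T x + y) \<partial>lborel) = emeasure (distr lborel borel T) A" for y
  proof -
    have "(\<integral>\<^sup>+x. indicator A (T x + y) \<partial>lborel) = (\<integral>\<^sup>+x. indicator A (T (S y + x)) \<partial>lborel)"
      using lin by (simp add: linear_add S add.commute)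
    also have "\<dots> = (\<integral>\<^sup>+x. indicator A (T x) \<partial>lborel)"
      by (rule nn_integral_lborel_translation[where f="\<lambda>x. indicator A (T x)"]) measurable
    also have "\<dots> = (\<integral>\<^sup>+x. indicator A x \<partial>distr lborel borel T)"
      by (subst nn_integral_distr) auto
    also have "\<dots> = emeasure (distr lborel borel T) A" by simp
    finally show ?thesis .
  qed
  have ball: "(\<integral>\<^sup>+x. indicator B (y - T x) \<partial>lborel) = c" for y
  proof -
    have "norm (y - T x) = norm (- S y + x)" for x
    proof -
      have "norm (y - T x) = norm (S (y - T x))"
        using S(1) by (simp add: orthogonal_transformation_norm)
      also have "S (y - T x) = S y - x"
        using S(1) by (simp add: orthogonal_transformation_def linear_diff S(3))
      finally show ?thesis by (simp add: norm_minus_commute)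
    qed
    then have "(\<integral>\<^sup>+x. indicator B (y - T x) \<partial>lborel) = (\<integral>\<^sup>+x. indicator B (- S y + x) \<partial>lborel)"
      by (intro nn_integral_cong) (auto simp: B_def indicator_def)
    also have "\<dots> = (\<integral>\<^sup>+x. indicator B x \<partial>lborel)"
      by (rule nn_integral_lborel_translation) measurable
    finally show ?thesis by (simp add: c_def)
  qed
  have "c * emeasure (distr lborel borel T) A
      = (\<integral>\<^sup>+y. indicator B y * (\<integral>\<^sup>+x. indicator A (T x + y) \<partial>lborel) \<partial>lborel)"
    by (simp add: shift nn_integral_multc c_def)
  also have "\<dots> = (\<integral>\<^sup>+y. (\<integral>\<^sup>+x. indicator B y * indicator A (T x + y) \<partial>lborel) \<partial>lborel)"
    by (intro nn_integral_cong nn_integral_cmult[symmetric]) measurable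
  also have "\<dots> = (\<integral>\<^sup>+x. (\<integral>\<^sup>+y. indicator B y * indicator A (T x + y) \<partial>lborel) \<partial>lborel)"
    by (rule lborel_pair.Fubini') measurable
  also have "\<dots> = (\<integral>\<^sup>+x. (\<integral>\<^sup>+y. indicator B (y - T x) * indicator A y \<partial>lborel) \<partial>lborel)"
  proof (rule nn_integral_cong)
    fix x
    show "(\<integral>\<^sup>+y. indicator B y * indicator A (T x + y) \<partial>lborel)
        = (\<integral>\<^sup>+y. indicator B (y - T x) * indicator A y \<partial>(lborel::'a measure))"
      using nn_integral_lborel_translation[where f="\<lambda>y. indicator B (y - T x) * indicator A y" and c="T x"]
      by simp
  qed
  also have "\<dots> = (\<integral>\<^sup>+y. (\<integral>\<^sup>+x. indicator B (y - T x) * indicator A y \<partial>lborel) \<partial>lborel)"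
    by (rule lborel_pair.Fubini') measurable
  also have "\<dots> = (\<integral>\<^sup>+y. c * indicator A y \<partial>lborel)"
    by (intro nn_integral_cong) (simp add: nn_integral_multc ball)
  also have "\<dots> = c * emeasure lborel A" by (simp add: nn_integral_cmult)
  finally show "emeasure (distr lborel borel T) A = emeasure lborel A"
    using c_fin by (simp add: ennreal_mult_cancel_left)
qed

text \<open>Since the image measure is \<open>lborel\<close> itself, preimages of null sets are
  null; this is what makes \<open>T\<close> measurable between the completed measures.\<close>

lemma lebesgue_distr_orthogonal:
  fixes T :: "'a::euclidean_space \<Rightarrow> 'a"
  assumes T: "orthogonal_transformation T"
  shows "T \<in> lebesgue \<rightarrow>\<^sub>M lebesgue" "distr lebesgue lebesgue T = lebesgue"
proof -
  have "linear T" using T by (simp add: orthogonal_transformation_def)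
  then have contT: "continuous_on UNIV T" by (simp add: linear_continuous_on linear_conv_bounded_linear)
  have T_borel[measurable]: "T \<in> borel \<rightarrow>\<^sub>M borel" using contT by (rule borel_measurable_continuous_onI)
  have dist: "distr lebesgue lborel T = lborel"
    using distr_completion[of T lborel lborel] lborel_distr_orthogonal[OF T]
    by (simp cong: distr_cong)
  show TT: "T \<in> lebesgue \<rightarrow>\<^sub>M lebesgue"
    by (rule completion.measurable_completion2)
       (auto simp: dist intro!: measurable_completion)
  have "completion (distr lebesgue lborel T) = distr lebesgue lebesgue T"
    by (rule completion.completion_distr_eq) (auto simp: dist intro!: measurable_completion)
  then show "distr lebesgue lebesgue T = lebesgue" by (simp add: dist)
qed

lemma
  fixes T :: "'a::euclidean_space \<Rightarrow> 'a" and h :: "'a \<Rightarrow> 'b::{banach,second_countable_topology}"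
  assumes T: "orthogonal_transformation T"
  shows integrable_lebesgue_orthogonal: "integrable lebesgue h \<Longrightarrow> integrable lebesgue (\<lambda>x. h (T x))"
    and integral_lebesgue_orthogonal: "integrable lebesgue h \<Longrightarrow> (LINT x|lebesgue. h (T x)) = (LINT x|lebesgue. h x)"
proof -
  note [measurable] = lebesgue_distr_orthogonal(1)[OF T]
  assume h: "integrable lebesgue h"
  then have [measurable]: "h \<in> borel_measurable lebesgue" by auto
  show "integrable lebesgue (\<lambda>x. h (T x))"
    using h integrable_distr_eq[of T lebesgue lebesgue h] by (simp add: lebesgue_distr_orthogonal(2)[OF T])
  show "(LINT x|lebesgue. h (T x)) = (LINT x|lebesgue. h x)"
    using integral_distr[of T lebesgue lebesgue h] by (simp add: lebesgue_distr_orthogonal(2)[OF T])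
qed

subsection \<open>The dominant chamber as a fundamental domain\<close>

lemma orthogonal_transformation_reflection: "orthogonal_transformation (reflection a)"
proof -
  have "linear (reflection a)"
    by (rule linearI)
       (simp_all add: reflection_def algebra_simps inner_add_left add_divide_distrib scaleR_add_left)
  moreover have "reflection a v \<bullet> reflection a w = v \<bullet> w" for v w
  \<comment> \<open>For \<open>a = 0\<close> the quotient in \<open>reflection\<close> is 0 by the
    convention on division, so the map is the identity. Otherwise the quadratic term cancels the two
    cross terms.\<close>
  proof (cases "a = 0")
    case False
    define k where "k v = 2 * (v \<bullet> a) / (a \<bullet> a)" for v
    have k: "k v * (a \<bullet> a) = 2 * (v \<bullet> a)" for v using False by (simp add: k_def)
    have "reflection a v \<bullet> reflection a w
        = v \<bullet> w - k w * (v \<bullet> a) - k v * (w \<bullet> a) + k w * (k v * (a \<bullet> a))"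
      unfolding reflection_def k_def[symmetric]
      by (simp add: inner_diff_left inner_diff_right inner_commute[of a w] algebra_simps)
    then show ?thesis unfolding k by (simp add: k_def)
  qed (simp add: reflection_def)
  ultimately show ?thesis by (simp add: orthogonal_transformation_def)
qed

lemma reflection_reflection [simp]: "reflection a (reflection a x) = x"
proof (cases "a = 0")
  case False
  then have "a \<bullet> a \<noteq> 0" by simp
  then show ?thesis
    by (simp add: reflection_def inner_diff_left algebra_simps flip: scaleR_add_left)
qed (simp add: reflection_def)

lemma reflection_self: "a \<noteq> 0 \<Longrightarrow> reflection a a = - a"
  by (simp add: reflection_def algebra_simps scaleR_2)

lemma orthogonal_transformation_weyl_group:
  "w \<in> weyl_group \<alpha> \<Longrightarrow> orthogonal_transformation w"
proof (induction rule: weyl_group.induct)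
  case id
  show ?case by (simp add: id_def)
next
  case (reflection w i)
  then show ?case
    by (intro orthogonal_transformation_compose orthogonal_transformation_reflection)
qed

lemma linear_weyl_group: "w \<in> weyl_group \<alpha> \<Longrightarrow> linear w"
  by (simp add: orthogonal_transformation_linear orthogonal_transformation_weyl_group)

lemma inner_weyl_group: "w \<in> weyl_group \<alpha> \<Longrightarrow> w x \<bullet> w y = x \<bullet> y"
  using orthogonal_transformation_weyl_group by (auto simp: orthogonal_transformation_def)

lemma weyl_group_comp:
  assumes "u \<in> weyl_group \<alpha>" "w \<in> weyl_group \<alpha>"
  shows "u \<circ> w \<in> weyl_group \<alpha>"
  using assms
proof (induction rule: weyl_group.induct)
  case (reflection u i)
  then show ?case by (metis comp_assoc weyl_group.reflection)
qed simp

lemma reflection_in_weyl_group: "reflection (\<alpha> i) \<in> weyl_group \<alpha>"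
  using weyl_group.reflection[OF weyl_group.id, of \<alpha> i] by simp

text \<open>The inductive definition attaches generators on the left only, so the inverse, which
  gains a reflection on the right, is obtained from closure under composition.\<close>

lemma weyl_group_left_inverse:
  assumes "w \<in> weyl_group \<alpha>"
  shows "\<exists>v\<in>weyl_group \<alpha>. v \<circ> w = id \<and> w \<circ> v = id"
  using assms
proof (induction rule: weyl_group.induct)
  case id
  show ?case using weyl_group.id by (intro bexI[of _ id]) auto
next
  case (reflection w i)
  then obtain v where v: "v \<in> weyl_group \<alpha>" "v \<circ> w = id" "w \<circ> v = id" by blast
  show ?case
    using v weyl_group_comp[OF v(1) reflection_in_weyl_group[of \<alpha> i]]
    by (intro bexI[of _ "v \<circ> reflection (\<alpha> i)"]) (auto simp: fun_eq_iff)
qed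

lemma bij_weyl_group: "w \<in> weyl_group \<alpha> \<Longrightarrow> bij w"
  by (rule orthogonal_transformation_bij[OF orthogonal_transformation_weyl_group])

lemma weyl_group_inv:
  assumes "w \<in> weyl_group \<alpha>"
  shows "inv w \<in> weyl_group \<alpha>"
proof -
  obtain v where v: "v \<in> weyl_group \<alpha>" "v \<circ> w = id" "w \<circ> v = id"
    using weyl_group_left_inverse[OF assms] by blast
  have "inv w = v" using v by (metis inv_unique_comp)
  with v show ?thesis by simp
qed

lemma inner_weyl_group_inv:
  assumes "w \<in> weyl_group \<alpha>"
  shows "x \<bullet> w y = inv w x \<bullet> y"
  using inner_weyl_group[OF assms, of "inv w x" y] bij_weyl_group[OF assms]
  by (simp add: bij_is_surj surj_f_inv_f)

lemma bij_betw_inv_weyl_group: "bij_betw inv (weyl_group \<alpha>) (weyl_group \<alpha>)"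
  by (rule bij_betwI[of _ _ _ inv]) (auto intro: weyl_group_inv simp: inv_inv_eq bij_weyl_group)

lemma weyl_group_root:
  assumes "root_system R" "simple_roots R \<alpha>" "w \<in> weyl_group \<alpha>" "b \<in> R"
  shows "w b \<in> R"
  using assms(3,4)
proof (induction arbitrary: b rule: weyl_group.induct)
  case (reflection w i)
  then show ?case using assms(1,2) unfolding root_system_def simple_roots_def by (metis comp_apply range_subsetD)
qed simp

text \<open>Group elements map the finite set \<open>R\<close> into itself, and being linear they
  are determined by their values on \<open>R\<close>, which spans.\<close>

lemma finite_weyl_group:
  assumes R: "root_system R" and \<alpha>: "simple_roots R \<alpha>"
  shows "finite (weyl_group \<alpha>)"
proof (rule finite_imageD)
  have "(\<lambda>w. restrict w R) ` weyl_group \<alpha> \<subseteq> R \<rightarrow>\<^sub>E R"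
    using weyl_group_root[OF R \<alpha>] by auto
  moreover have "finite (R \<rightarrow>\<^sub>E R)"
    using R by (intro finite_PiE) (auto simp: root_system_def)
  ultimately show "finite ((\<lambda>w. restrict w R) ` weyl_group \<alpha>)" by (rule finite_subset)
  show "inj_on (\<lambda>w. restrict w R) (weyl_group \<alpha>)"
  proof (rule inj_onI)
    fix u w assume u: "u \<in> weyl_group \<alpha>" and w: "w \<in> weyl_group \<alpha>" and eq: "restrict u R = restrict w R"
    have "u x = w x" for x
    proof (rule linear_eq_on[of u w x R])
      show "linear u" "linear w" using u w by (auto intro: linear_weyl_group)
      show "x \<in> span R" using R by (simp add: root_system_def)
      show "u b = w b" if "b \<in> R" for b using eq that by (metis restrict_apply')
    qed
    then show "u = w" by auto
  qed
qed

section \<open>Signs of roots relative to the simple roots\<close>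

lemma simple_roots_coeff_unique:
  fixes \<alpha> :: "'n \<Rightarrow> real ^ 'n"
  assumes \<alpha>: "simple_roots R \<alpha>" and eq: "(\<Sum>i\<in>UNIV. c i *\<^sub>R \<alpha> i) = (\<Sum>i\<in>UNIV. d i *\<^sub>R \<alpha> i)"
  shows "c i = d i"
proof -
  have inj: "inj \<alpha>" and ind: "independent (range \<alpha>)" using \<alpha> by (auto simp: simple_roots_def)
  \<comment> \<open>Independence speaks of the set \<open>range \<alpha>\<close>; injectivity
    transfers it to coefficients indexed by the family.\<close>
  have "(\<Sum>v\<in>range \<alpha>. (c (inv \<alpha> v) - d (inv \<alpha> v)) *\<^sub>R v) = (\<Sum>i\<in>UNIV. (c i - d i) *\<^sub>R \<alpha> i)"
    using inj by (simp add: sum.reindex)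
  also have "\<dots> = 0" using eq by (simp add: scaleR_diff_left sum_subtractf)
  finally have "c (inv \<alpha> (\<alpha> i)) - d (inv \<alpha> (\<alpha> i)) = 0"
    using independentD[OF ind, of "range \<alpha>" "\<lambda>v. c (inv \<alpha> v) - d (inv \<alpha> v)" "\<alpha> i"] by simp
  then show ?thesis using inj by simp
qed

lemma simple_root_nonzero:
  assumes "simple_roots R \<alpha>"
  shows "\<alpha> i \<noteq> 0"
  using assms dependent_zero[of "range \<alpha>"] by (metis rangeI simple_roots_def)

definition positive_combination :: "('n \<Rightarrow> real ^ 'n) \<Rightarrow> real ^ 'n \<Rightarrow> bool" where
  "positive_combination \<alpha> b \<longleftrightarrow> (\<exists>c. (\<forall>i. 0 \<le> c i) \<and> b = (\<Sum>i\<in>UNIV. c i *\<^sub>R \<alpha> i))"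

lemma root_sign:
  assumes "simple_roots R \<alpha>" "b \<in> R"
  shows "positive_combination \<alpha> b \<or> positive_combination \<alpha> (- b)"
proof -
  from assms obtain c :: "'a \<Rightarrow> int" where c: "b = (\<Sum>i\<in>UNIV. real_of_int (c i) *\<^sub>R \<alpha> i)"
      "(\<forall>i. 0 \<le> c i) \<or> (\<forall>i. c i \<le> 0)"
    unfolding simple_roots_def by blast
  have "- b = (\<Sum>i\<in>UNIV. (- real_of_int (c i)) *\<^sub>R \<alpha> i)"
    using c(1) by (simp add: sum_negf)
  with c show ?thesis unfolding positive_combination_def
    by (metis neg_0_le_iff_le of_int_0_le_iff of_int_le_0_iff)
qed

lemma positive_combination_simple: "positive_combination \<alpha> (\<alpha> i)"
proof -
  have "\<alpha> i = (\<Sum>j\<in>UNIV. (if j = i then 1 else 0) *\<^sub>R \<alpha> j)"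
    by (simp add: if_distrib[of "\<lambda>c. c *\<^sub>R _"] cong: if_cong)
  moreover have "\<forall>j. 0 \<le> (if j = i then 1 else 0 :: real)" by simp
  ultimately show ?thesis unfolding positive_combination_def
    by (intro exI[of _ "\<lambda>j. if j = i then 1 else 0"] conjI)
qed

lemma positive_combination_inner_nonneg:
  assumes "positive_combination \<alpha> b" "x \<in> dominant_chamber \<alpha>"
  shows "0 \<le> x \<bullet> b"
  using assms by (auto simp: positive_combination_def dominant_chamber_def inner_sum_right intro!: sum_nonneg)

text \<open>A simple reflection changes only the \<open>i\<close>-th coefficient, so it can turn a positive
  combination into a negative one only if all the other coefficients vanish.\<close>

lemma sign_change_reflection:
  fixes \<alpha> :: "'n \<Rightarrow> real ^ 'n"
  assumes \<alpha>: "simple_roots R \<alpha>"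
    and b: "positive_combination \<alpha> b" and rb: "positive_combination \<alpha> (- reflection (\<alpha> i) b)"
  shows "\<exists>c. b = c *\<^sub>R \<alpha> i"
proof -
  obtain c where c: "\<And>i. 0 \<le> c i" "b = (\<Sum>i\<in>UNIV. c i *\<^sub>R \<alpha> i)"
    using b by (auto simp: positive_combination_def)
  obtain d where d: "\<And>i. 0 \<le> d i" "- reflection (\<alpha> i) b = (\<Sum>i\<in>UNIV. d i *\<^sub>R \<alpha> i)"
    using rb by (auto simp: positive_combination_def)
  define k where "k = 2 * (b \<bullet> \<alpha> i) / (\<alpha> i \<bullet> \<alpha> i)"
  have "(\<Sum>j\<in>UNIV. (c j + d j) *\<^sub>R \<alpha> j) = b - reflection (\<alpha> i) b"
    unfolding c(2)[symmetric] diff_conv_add_uminus d(2) scaleR_add_left sum.distrib by simp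
  also have "\<dots> = k *\<^sub>R \<alpha> i" by (simp add: reflection_def k_def)
  also have "\<dots> = (\<Sum>j\<in>UNIV. (if j = i then k else 0) *\<^sub>R \<alpha> j)"
    by (simp add: if_distrib[of "\<lambda>c. c *\<^sub>R _"] cong: if_cong)
  finally have eq: "c j + d j = (if j = i then k else 0)" for j
    by (rule simple_roots_coeff_unique[OF \<alpha>])
  have "c j = 0" if "j \<noteq> i" for j using eq[of j] c(1)[of j] d(1)[of j] that by simp
  then have "b = (\<Sum>j\<in>UNIV. (if j = i then c i else 0) *\<^sub>R \<alpha> j)"
    unfolding c(2) by (intro sum.cong) auto
  also have "\<dots> = c i *\<^sub>R \<alpha> i"
    by (simp add: if_distrib[of "\<lambda>c. c *\<^sub>R _"] cong: if_cong)
  finally show ?thesis by blast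
qed

text \<open>\<open>sign_change_reflection\<close> identifies a root only up to a factor; a nonzero
  factor does not change the reflection, so non-reduced systems need no separate case.\<close>

lemma reflection_scaleR_cong:
  assumes "c \<noteq> 0"
  shows "reflection (c *\<^sub>R a) = reflection a"
  using assms by (cases "a = 0") (auto simp: fun_eq_iff reflection_def)

lemma weyl_group_conj_reflection:
  assumes "w \<in> weyl_group \<alpha>"
  shows "w (reflection a x) = reflection (w a) (w x)"
  using assms by (simp add: reflection_def linear_diff[OF linear_weyl_group] linear_scale[OF linear_weyl_group] inner_weyl_group)

section \<open>Words in the simple reflections and the exchange condition\<close>

definition reflection_word :: "('n \<Rightarrow> real ^ 'n) \<Rightarrow> 'n list \<Rightarrow> real ^ 'n \<Rightarrow> real ^ 'n" where
  "reflection_word \<alpha> ws = foldr (\<lambda>i u. reflection (\<alpha> i) \<circ> u) ws id"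

lemma reflection_word_simps [simp]:
  "reflection_word \<alpha> [] = id"
  "reflection_word \<alpha> (i # ws) = reflection (\<alpha> i) \<circ> reflection_word \<alpha> ws"
  by (simp_all add: reflection_word_def)

lemma reflection_word_append: "reflection_word \<alpha> (us @ ws) = reflection_word \<alpha> us \<circ> reflection_word \<alpha> ws"
  by (induction us) (auto simp: comp_assoc)

lemma reflection_word_in_weyl_group: "reflection_word \<alpha> ws \<in> weyl_group \<alpha>"
  by (induction ws) (simp_all only: reflection_word_simps weyl_group.intros)

lemma weyl_group_word:
  assumes "w \<in> weyl_group \<alpha>"
  shows "\<exists>ws. w = reflection_word \<alpha> ws"
  using assms
proof (induction rule: weyl_group.induct)
  case id
  then show ?case by (metis reflection_word_simps(1))
next
  case (reflection w i)
  then show ?case by (metis reflection_word_simps(2))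
qed

text \<open>The image of \<open>\<alpha> t\<close> under some suffix of the word becomes negative at a first letter \<open>i\<close>;
  that letter can be cancelled against the reflection in \<open>\<alpha> t\<close>.\<close>

lemma exchange:
  fixes \<alpha> :: "'n \<Rightarrow> real ^ 'n"
  assumes R: "root_system R" and \<alpha>: "simple_roots R \<alpha>"
    and "\<not> positive_combination \<alpha> (reflection_word \<alpha> ws (\<alpha> t))"
  shows "\<exists>us. Suc (length us) = length ws \<and> reflection_word \<alpha> ws \<circ> reflection (\<alpha> t) = reflection_word \<alpha> us"
  using assms(3)
proof (induction ws)
  case Nil
  then show ?case by (simp add: positive_combination_simple)
next
  case (Cons i ws)
  let ?w = "reflection_word \<alpha> ws"
  have w: "?w \<in> weyl_group \<alpha>" by (rule reflection_word_in_weyl_group)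
  have root: "?w (\<alpha> t) \<in> R" "reflection (\<alpha> i) (?w (\<alpha> t)) \<in> R"
    using weyl_group_root[OF R \<alpha> w, of "\<alpha> t"] weyl_group_root[OF R \<alpha> weyl_group.reflection[OF w, of i], of "\<alpha> t"] \<alpha>
    by (auto simp: simple_roots_def)
  show ?case
  proof (cases "positive_combination \<alpha> (?w (\<alpha> t))")
    case False
    then obtain us where us: "Suc (length us) = length ws" "?w \<circ> reflection (\<alpha> t) = reflection_word \<alpha> us"
      using Cons.IH by blast
    then have "reflection_word \<alpha> (i # ws) \<circ> reflection (\<alpha> t) = reflection_word \<alpha> (i # us)"
      by (simp add: comp_assoc)
    with us(1) show ?thesis by (metis length_Cons)
  next
    case True
    have "positive_combination \<alpha> (- reflection (\<alpha> i) (?w (\<alpha> t)))"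
      using root_sign[OF \<alpha> root(2)] Cons.prems by simp
    then obtain c where c: "?w (\<alpha> t) = c *\<^sub>R \<alpha> i"
      using sign_change_reflection[OF \<alpha> True] by blast
    have "c \<noteq> 0" using c root(1) R by (auto simp: root_system_def)
    then have "reflection (?w (\<alpha> t)) = reflection (\<alpha> i)" unfolding c by (rule reflection_scaleR_cong)
    then have "reflection (\<alpha> i) \<circ> ?w \<circ> reflection (\<alpha> t) = ?w"
      by (simp add: fun_eq_iff weyl_group_conj_reflection[OF w])
    then show ?thesis by (metis length_Cons reflection_word_simps(2))
  qed
qed

text \<open>A shortest word for \<open>w\<close> with last letter \<open>t\<close> has a prefix
  sending \<open>\<alpha> t\<close> to \<open>- w (\<alpha> t)\<close>. This vector pairs strictly
  negatively with the dominant point \<open>w x\<close>, so it is not a positive combination, and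
  the exchange condition gives a word for \<open>w\<close> that is two letters shorter.\<close>

lemma weyl_group_chamber_trivial:
  fixes \<alpha> :: "'n \<Rightarrow> real ^ 'n"
  assumes R: "root_system R" and \<alpha>: "simple_roots R \<alpha>"
    and w: "w \<in> weyl_group \<alpha>" and x: "\<And>i. 0 < x \<bullet> \<alpha> i" and wx: "w x \<in> dominant_chamber \<alpha>"
  shows "w = id"
proof (rule ccontr)
  assume "w \<noteq> id"
  obtain ws where ws: "w = reflection_word \<alpha> ws"
    and min: "\<And>us. w = reflection_word \<alpha> us \<Longrightarrow> length ws \<le> length us"
    using weyl_group_word[OF w] ex_has_least_nat[of "\<lambda>ws. w = reflection_word \<alpha> ws" _ length] by metis
  have "ws \<noteq> []" using ws \<open>w \<noteq> id\<close> by auto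
  then obtain vs t where vs: "ws = vs @ [t]" by (metis append_butlast_last_id)
  let ?v = "reflection_word \<alpha> vs"
  have v: "w = ?v \<circ> reflection (\<alpha> t)" using ws vs by (simp add: reflection_word_append)
  have "w (\<alpha> t) = - ?v (\<alpha> t)"
    using simple_root_nonzero[OF \<alpha>] linear_neg[OF linear_weyl_group[OF reflection_word_in_weyl_group]]
    by (simp add: v reflection_self)
  moreover have "w x \<bullet> w (\<alpha> t) = x \<bullet> \<alpha> t" by (rule inner_weyl_group[OF w])
  ultimately have "w x \<bullet> ?v (\<alpha> t) < 0" using x[of t] by simp
  then have "\<not> positive_combination \<alpha> (?v (\<alpha> t))"
    using positive_combination_inner_nonneg[OF _ wx] by (meson not_le)
  from exchange[OF R \<alpha> this] obtain us where "Suc (length us) = length vs" "w = reflection_word \<alpha> us"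
    using v by auto
  with min[of us] vs show False by simp
qed

section \<open>Existence and almost everywhere uniqueness of dominant representatives\<close>

lemma exists_strictly_dominant:
  fixes \<alpha> :: "'n \<Rightarrow> real ^ 'n"
  assumes \<alpha>: "simple_roots R \<alpha>"
  shows "\<exists>\<rho>. \<forall>i. 0 < \<rho> \<bullet> \<alpha> i"
proof -
  define L :: "real ^ 'n \<Rightarrow> real ^ 'n" where "L x = (\<chi> i. x \<bullet> \<alpha> i)" for x
  have lin: "linear L" by (rule linearI) (auto simp: L_def vec_eq_iff inner_add_left)
  have inj: "inj \<alpha>" and ind: "independent (range \<alpha>)" using \<alpha> by (auto simp: simple_roots_def)
  have "card (range \<alpha>) = CARD('n)" using inj by (simp add: card_image)
  then have span: "span (range \<alpha>) = UNIV"
    using ind card_ge_dim_independent[of "range \<alpha>" UNIV] by auto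
  have "inj L"
  proof (subst linear_injective_0[OF lin], intro allI impI)
    fix x assume "L x = 0"
    then have "x \<bullet> \<alpha> i = 0" for i by (simp add: L_def vec_eq_iff)
    then have "orthogonal x y" if "y \<in> span (range \<alpha>)" for y
      using that by (intro orthogonal_to_span[OF that]) (auto simp: orthogonal_def)
    then show "x = 0" using span by (simp add: orthogonal_def) (metis inner_eq_zero_iff)
  qed
  then have "surj L" using lin linear_injective_imp_surjective by blast
  \<comment> \<open>A vector pairing to 1 with every simple root, that is, the sum of the basis dual
    to the simple roots.\<close>
  then obtain \<rho> where "L \<rho> = (\<chi> i. 1)" by (metis surjD)
  then have "\<rho> \<bullet> \<alpha> i = 1" for i by (simp add: L_def vec_eq_iff)
  then show ?thesis by (intro exI[of _ \<rho>]) simp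
qed

lemma exists_weyl_group_dominant:
  fixes \<alpha> :: "'n \<Rightarrow> real ^ 'n"
  assumes R: "root_system R" and \<alpha>: "simple_roots R \<alpha>"
  shows "\<exists>w\<in>weyl_group \<alpha>. w x \<in> dominant_chamber \<alpha>"
proof -
  obtain \<rho> where \<rho>: "\<And>i. 0 < \<rho> \<bullet> \<alpha> i" using exists_strictly_dominant[OF \<alpha>] by blast
  have fin: "finite (weyl_group \<alpha>)" by (rule finite_weyl_group[OF R \<alpha>])
  have ne: "weyl_group \<alpha> \<noteq> {}" using weyl_group.id by blast
  obtain w where w: "w \<in> weyl_group \<alpha>" and max: "\<And>u. u \<in> weyl_group \<alpha> \<Longrightarrow> u x \<bullet> \<rho> \<le> w x \<bullet> \<rho>"
  proof -
    let ?S = "(\<lambda>w. w x \<bullet> \<rho>) ` weyl_group \<alpha>"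
    have "Max ?S \<in> ?S" using fin ne by (intro Max_in) auto
    then obtain w where "w \<in> weyl_group \<alpha>" "w x \<bullet> \<rho> = Max ?S" by auto
    with that[of w] fin show ?thesis by simp
  qed
  have "0 \<le> w x \<bullet> \<alpha> i" for i
  proof -
    have "reflection (\<alpha> i) (w x) \<bullet> \<rho> \<le> w x \<bullet> \<rho>"
      using max[OF weyl_group.reflection[OF w, of i]] by simp
    \<comment> \<open>The reflection in \<open>\<alpha> i\<close> lowers the pairing with
      \<open>\<rho>\<close> by exactly this amount, whose sign is that of
      \<open>w x \<bullet> \<alpha> i\<close>; maximality forces it to be nonnegative.\<close>
    then have "0 \<le> 2 * (w x \<bullet> \<alpha> i) / (\<alpha> i \<bullet> \<alpha> i) * (\<rho> \<bullet> \<alpha> i)"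
      by (simp add: reflection_def inner_diff_left inner_commute[of "\<alpha> i" \<rho>])
    moreover have "0 < 2 / (\<alpha> i \<bullet> \<alpha> i) * (\<rho> \<bullet> \<alpha> i)"
      using \<rho>[of i] simple_root_nonzero[OF \<alpha>, of i] by simp
    ultimately show ?thesis
      using zero_le_mult_iff[of "w x \<bullet> \<alpha> i" "2 / (\<alpha> i \<bullet> \<alpha> i) * (\<rho> \<bullet> \<alpha> i)"] by (simp add: mult_ac)
  qed
  with w show ?thesis by (auto simp: dominant_chamber_def)
qed

lemma dominant_chamber_measurable [measurable]: "dominant_chamber \<alpha> \<in> sets borel"
proof -
  have "dominant_chamber \<alpha> = (\<Inter>i. {x. 0 \<le> x \<bullet> \<alpha> i})" by (auto simp: dominant_chamber_def)
  moreover have "closed (\<Inter>i. {x. 0 \<le> x \<bullet> \<alpha> i})"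
    by (intro closed_INT ballI closed_Collect_le continuous_intros)
  ultimately show ?thesis by simp
qed

text \<open>The sum counts the group elements that move \<open>x\<close> into the closed chamber. It
  can exceed 1 on the images of the walls, which form finitely many hyperplanes and hence a null
  set.\<close>

lemma AE_weyl_chambers_partition:
  fixes \<alpha> :: "'n \<Rightarrow> real ^ 'n"
  assumes R: "root_system R" and \<alpha>: "simple_roots R \<alpha>"
  shows "AE x in lebesgue. (\<Sum>w\<in>weyl_group \<alpha>. indicator (dominant_chamber \<alpha>) (w x)) = (1::real)"
proof -
  let ?W = "weyl_group \<alpha>" and ?D = "dominant_chamber \<alpha>"
  have fin: "finite ?W" by (rule finite_weyl_group[OF R \<alpha>])
  have "AE x in lebesgue. \<forall>w\<in>?W. \<forall>i\<in>UNIV. w x \<bullet> \<alpha> i \<noteq> 0"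
  proof (intro AE_finite_allI fin finite)
    fix w :: "real ^ 'n \<Rightarrow> real ^ 'n" and i assume w: "w \<in> ?W"
    let ?a = "inv w (\<alpha> i)"
    have eq: "w x \<bullet> \<alpha> i = ?a \<bullet> x" for x
      using inner_weyl_group_inv[OF w, of "\<alpha> i" x] by (simp add: inner_commute)
    have "?a \<noteq> 0"
      using bij_weyl_group[OF w] simple_root_nonzero[OF \<alpha>, of i] linear_0[OF linear_weyl_group[OF w]]
      by (metis bij_inv_eq_iff)
    then have "negligible {x. ?a \<bullet> x = 0}" by (intro negligible_hyperplane) simp
    then have "{x. ?a \<bullet> x = 0} \<in> null_sets lebesgue" by (simp add: negligible_iff_null_sets)
    then show "AE x in lebesgue. w x \<bullet> \<alpha> i \<noteq> 0" by (rule AE_I') (auto simp: eq)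
  qed
  then show ?thesis
  proof eventually_elim
    fix x assume reg: "\<forall>w\<in>?W. \<forall>i\<in>UNIV. w x \<bullet> \<alpha> i \<noteq> 0"
    obtain u where u: "u \<in> ?W" "u x \<in> ?D" using exists_weyl_group_dominant[OF R \<alpha>] by blast
    have strict: "0 < u x \<bullet> \<alpha> i" for i
      using u reg by (auto simp: dominant_chamber_def less_le)
    have unique: "w = u" if w: "w \<in> ?W" "w x \<in> ?D" for w
    proof -
      have inv: "inv u (u y) = y" for y using bij_weyl_group[OF u(1)] by (simp add: bij_is_inj)
      \<comment> \<open>This composite carries the strictly dominant point \<open>u x\<close> to the
        dominant point \<open>w x\<close>, so it is trivial.\<close>
      have "w \<circ> inv u = id"
        using w u by (intro weyl_group_chamber_trivial[OF R \<alpha> weyl_group_comp strict]) (auto intro: weyl_group_inv simp: inv)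
      then have "w (inv u (u y)) = u y" for y by (simp add: fun_eq_iff)
      then show "w = u" by (auto simp: inv)
    qed
    have "indicator ?D (w x) = (if w = u then 1 else 0 :: real)" if "w \<in> ?W" for w
    proof (cases "w = u")
      case False
      with unique that have "w x \<notin> ?D" by blast
      with False show ?thesis by simp
    qed (use u(2) in simp)
    then have "(\<Sum>w\<in>?W. indicator ?D (w x)) = (\<Sum>w\<in>?W. if w = u then 1 else 0 :: real)"
      by (rule sum.cong[OF refl])
    also have "\<dots> = 1" using fin u by simp
    finally show "(\<Sum>w\<in>?W. indicator ?D (w x)) = (1::real)" .
  qed
qed

section \<open>Folding whole-space integrals onto the chamber\<close>

lemma integral_weyl_chambers:
  fixes \<alpha> :: "'n \<Rightarrow> real ^ 'n" and h :: "real ^ 'n \<Rightarrow> 'b::{banach,second_countable_topology}"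
  assumes R: "root_system R" and \<alpha>: "simple_roots R \<alpha>" and h: "integrable lebesgue h"
  shows "\<And>w. w \<in> weyl_group \<alpha> \<Longrightarrow> set_integrable lebesgue (dominant_chamber \<alpha>) (\<lambda>x. h (w x))"
    and "(LINT x|lebesgue. h x) = (\<Sum>w\<in>weyl_group \<alpha>. LINT x:dominant_chamber \<alpha>|lebesgue. h (w x))"
proof -
  let ?W = "weyl_group \<alpha>" and ?D = "dominant_chamber \<alpha>"
  have fin: "finite ?W" by (rule finite_weyl_group[OF R \<alpha>])
  note [measurable] = borel_measurable_integrable[OF h]
  have [measurable]: "?D \<in> sets lebesgue" using dominant_chamber_measurable by (simp add: sets_completionI_sets)
  show setint: "set_integrable lebesgue ?D (\<lambda>x. h (w x))" if w: "w \<in> ?W" for w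
    unfolding set_integrable_def
    by (intro integrable_mult_indicator integrable_lebesgue_orthogonal[OF orthogonal_transformation_weyl_group[OF w] h]) measurable
  \<comment> \<open>The piece of \<open>h\<close> where \<open>w x\<close> lies in the chamber is
    moved there by the substitution of \<open>w x\<close> for \<open>x\<close>. This leaves
    \<open>inv w\<close> inside \<open>h\<close>, which the reindexing by inversion removes at the
    end.\<close>
  have piece: "integrable lebesgue (\<lambda>x. indicator ?D (w x) *\<^sub>R h x)"
    "(LINT x|lebesgue. indicator ?D (w x) *\<^sub>R h x) = (LINT x:?D|lebesgue. h (inv w x))" if w: "w \<in> ?W" for w
  proof -
    have inv: "inv w (w y) = y" for y using bij_weyl_group[OF w] by (simp add: bij_is_inj)
    note w' = orthogonal_transformation_weyl_group[OF w]
    have int: "integrable lebesgue (\<lambda>x. indicator ?D x *\<^sub>R h (inv w x))"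
      using setint[OF weyl_group_inv[OF w]] by (simp add: set_integrable_def)
    show "integrable lebesgue (\<lambda>x. indicator ?D (w x) *\<^sub>R h x)"
      using integrable_lebesgue_orthogonal[OF w' int] by (simp add: inv)
    show "(LINT x|lebesgue. indicator ?D (w x) *\<^sub>R h x) = (LINT x:?D|lebesgue. h (inv w x))"
      using integral_lebesgue_orthogonal[OF w' int] by (simp add: inv set_lebesgue_integral_def)
  qed
  have "(LINT x|lebesgue. h x) = (LINT x|lebesgue. (\<Sum>w\<in>?W. indicator ?D (w x) *\<^sub>R h x))"
  proof (rule integral_cong_AE)
    show "(\<lambda>x. \<Sum>w\<in>?W. indicator ?D (w x) *\<^sub>R h x) \<in> borel_measurable lebesgue"
      using piece(1) by (intro borel_measurable_sum) auto
    show "AE x in lebesgue. h x = (\<Sum>w\<in>?W. indicator ?D (w x) *\<^sub>R h x)"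
      using AE_weyl_chambers_partition[OF R \<alpha>] by eventually_elim (simp flip: scaleR_sum_left)
  qed measurable
  also have "\<dots> = (\<Sum>w\<in>?W. LINT x|lebesgue. indicator ?D (w x) *\<^sub>R h x)"
    using piece(1) by (intro Bochner_Integration.integral_sum)
  also have "\<dots> = (\<Sum>w\<in>?W. LINT x:?D|lebesgue. h (inv w x))"
    using piece(2) by (intro sum.cong) auto
  also have "\<dots> = (\<Sum>w\<in>?W. LINT x:?D|lebesgue. h (w x))"
    by (rule sum.reindex_bij_betw[OF bij_betw_inv_weyl_group])
  finally show "(LINT x|lebesgue. h x) = (\<Sum>w\<in>?W. LINT x:?D|lebesgue. h (w x))" .
qed

text \<open>Lets square integrability, assumed only on the chamber, feed the whole-space Plancherel
  formula. The translated pieces are integrable and add up to \<open>h\<close> almost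
  everywhere.\<close>

lemma integrable_weyl_invariant:
  fixes \<alpha> :: "'n \<Rightarrow> real ^ 'n" and h :: "real ^ 'n \<Rightarrow> 'b::{banach,second_countable_topology}"
  assumes R: "root_system R" and \<alpha>: "simple_roots R \<alpha>"
    and [measurable]: "h \<in> borel_measurable lebesgue"
    and inv: "\<And>w x. w \<in> weyl_group \<alpha> \<Longrightarrow> h (w x) = h x"
    and int: "set_integrable lebesgue (dominant_chamber \<alpha>) h"
  shows "integrable lebesgue h"
proof -
  let ?W = "weyl_group \<alpha>" and ?D = "dominant_chamber \<alpha>"
  have "integrable lebesgue (\<lambda>x. indicator ?D (w x) *\<^sub>R h (w x))" if "w \<in> ?W" for w
    using int integrable_lebesgue_orthogonal[OF orthogonal_transformation_weyl_group[OF that]]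
    unfolding set_integrable_def by blast
  then have "integrable lebesgue (\<lambda>x. \<Sum>w\<in>?W. indicator ?D (w x) *\<^sub>R h (w x))"
    by (rule Bochner_Integration.integrable_sum)
  then show ?thesis
  proof (rule integrable_cong_AE_imp)
    show "AE x in lebesgue. (\<Sum>w\<in>?W. indicator ?D (w x) *\<^sub>R h (w x)) = h x"
      using AE_weyl_chambers_partition[OF R \<alpha>]
      by eventually_elim (simp add: inv flip: scaleR_sum_left)
  qed measurable
qed

lemma integral_weyl_invariant:
  fixes \<alpha> :: "'n \<Rightarrow> real ^ 'n" and h :: "real ^ 'n \<Rightarrow> 'b::{banach,second_countable_topology}"
  assumes R: "root_system R" and \<alpha>: "simple_roots R \<alpha>" and h: "integrable lebesgue h"
    and inv: "\<And>w x. w \<in> weyl_group \<alpha> \<Longrightarrow> h (w x) = h x"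
  shows "(LINT x|lebesgue. h x) = real (card (weyl_group \<alpha>)) *\<^sub>R (LINT x:dominant_chamber \<alpha>|lebesgue. h x)"
  using integral_weyl_chambers(2)[OF R \<alpha> h] inv by (simp add: sum_constant_scaleR)

text \<open>The group elements pass over the invariant factor and collect on \<open>e\<close>. With
  \<open>e\<close> a character this sum becomes the orbit function, or its conjugate for the inverse
  transform.\<close>

lemma integral_weyl_chamber_times:
  fixes \<alpha> :: "'n \<Rightarrow> real ^ 'n" and f e :: "real ^ 'n \<Rightarrow> complex"
  assumes R: "root_system R" and \<alpha>: "simple_roots R \<alpha>" and fe: "integrable lebesgue (\<lambda>x. f x * e x)"
    and inv: "\<And>w x. w \<in> weyl_group \<alpha> \<Longrightarrow> f (w x) = f x"
  shows "(LINT x|lebesgue. f x * e x)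
    = (LINT x:dominant_chamber \<alpha>|lebesgue. f x * (\<Sum>w\<in>weyl_group \<alpha>. e (w x)))"
proof -
  let ?W = "weyl_group \<alpha>" and ?D = "dominant_chamber \<alpha>"
  have "(LINT x|lebesgue. f x * e x) = (\<Sum>w\<in>?W. LINT x:?D|lebesgue. f x * e (w x))"
    using integral_weyl_chambers(2)[OF R \<alpha> fe] inv by simp
  also have "\<dots> = (LINT x:?D|lebesgue. (\<Sum>w\<in>?W. f x * e (w x)))"
    using integral_weyl_chambers(1)[OF R \<alpha> fe] inv
    unfolding set_lebesgue_integral_def scaleR_sum_right
    by (intro Bochner_Integration.integral_sum[symmetric]) (simp add: set_integrable_def)
  finally show ?thesis by (simp add: sum_distrib_left)
qed

subsection \<open>Gaussian smoothing\<close>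

definition character :: "real \<Rightarrow> complex" where
  "character t = cis (2 * pi * t)"

lemma character_measurable [measurable]: "character \<in> borel_measurable borel"
  unfolding character_def by (intro borel_measurable_continuous_onI continuous_intros)

lemma norm_character [simp]: "norm (character t) = 1"
  by (simp add: character_def)

lemma character_add: "character (s + t) = character s * character t"
  by (simp add: character_def cis_mult algebra_simps)

lemma cnj_character [simp]: "cnj (character t) = character (- t)"
  by (simp add: character_def cis_cnj)

lemma character_zero [simp]: "character 0 = 1"
  by (simp add: character_def)

lemma character_sum: "finite I \<Longrightarrow> character (\<Sum>i\<in>I. f i) = (\<Prod>i\<in>I. character (f i))"
  by (induction I rule: finite_induct) (simp_all add: character_add)

text \<open>With the factor \<open>pi\<close> in the exponent, the Gaussian has total integral 1 and
  equals its own Fourier transform for the kernel \<open>character\<close>.\<close>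

definition gaussian :: "'a::euclidean_space \<Rightarrow> real" where
  "gaussian x = exp (- (pi * (norm x)\<^sup>2))"

lemma gaussian_measurable [measurable]: "gaussian \<in> borel_measurable borel"
  unfolding gaussian_def by measurable

lemma continuous_on_gaussian: "continuous_on A gaussian"
  unfolding gaussian_def by (intro continuous_intros)

lemma gaussian_pos: "0 < gaussian x" by (simp add: gaussian_def)

lemma gaussian_nonneg [simp]: "0 \<le> gaussian x" by (simp add: gaussian_def)

lemma gaussian_le_one: "gaussian x \<le> 1" by (simp add: gaussian_def)

lemma gaussian_minus [simp]: "gaussian (- x) = gaussian x" by (simp add: gaussian_def)

lemma gaussian_zero [simp]: "gaussian 0 = 1" by (simp add: gaussian_def)

lemma gaussian_prod: "gaussian x = (\<Prod>b\<in>Basis. gaussian (x \<bullet> b))"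
proof -
  have "(norm x)\<^sup>2 = (\<Sum>b\<in>Basis. (x \<bullet> b)\<^sup>2)"
    unfolding power2_norm_eq_inner by (subst euclidean_inner) (simp add: power2_eq_square)
  then show ?thesis
    by (simp add: gaussian_def exp_sum sum_distrib_left flip: sum_negf)
qed

lemma gaussian_character_integral_real:
  fixes t :: real
  shows "integrable lborel (\<lambda>x. complex_of_real (gaussian x) * character (t * x))"
    and "(LINT x|lborel. complex_of_real (gaussian x) * character (t * x)) = gaussian t"
proof -
  \<comment> \<open>Chosen so that \<open>(s * x)\<^sup>2 / 2 = pi * x\<^sup>2\<close>: after this
    rescaling the claim is the formula for the characteristic function of the standard normal
    law.\<close>
  define s where "s = sqrt (2 * pi)"
  have s: "s > 0" "s\<^sup>2 = 2 * pi" by (simp_all add: s_def)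
  have dens: "complex_of_real (std_normal_density (s * x)) = gaussian x / s" for x
    by (simp add: std_normal_density_def gaussian_def s_def[symmetric] power_mult_distrib s(2))
  have "complex_of_real (exp (- ((s * t)\<^sup>2) / 2)) = char std_normal_distribution (s * t)"
    by (simp add: char_std_normal_distribution)
  also have "\<dots> = (LINT x|lborel. std_normal_density x *\<^sub>R exp (\<i> * complex_of_real (s * t * x)))"
    unfolding char_def by (subst integral_density) (auto simp: normal_density_nonneg)
  also have "\<dots> = \<bar>s\<bar> *\<^sub>R (LINT x|lborel. std_normal_density (0 + s * x) *\<^sub>R exp (\<i> * complex_of_real (s * t * (0 + s * x))))"
    using s by (intro lborel_integral_real_affine) simp
  also have "\<dots> = (LINT x|lborel. s *\<^sub>R (std_normal_density (0 + s * x) *\<^sub>R exp (\<i> * complex_of_real (s * t * (0 + s * x)))))"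
    using s by (simp only: integral_scaleR_right abs_of_pos)
  also have "\<dots> = (LINT x|lborel. complex_of_real (gaussian x) * character (t * x))"
  proof (rule Bochner_Integration.integral_cong[OF refl])
    fix x
    have eq: "s * t * (0 + s * x) = 2 * pi * (t * x)"
      using s(2) by (simp add: power2_eq_square algebra_simps)
    show "s *\<^sub>R (std_normal_density (0 + s * x) *\<^sub>R exp (\<i> * complex_of_real (s * t * (0 + s * x))))
        = complex_of_real (gaussian x) * character (t * x)"
      unfolding eq using s(1) by (simp add: scaleR_conv_of_real dens character_def cis_conv_exp)
  qed
  finally show "(LINT x|lborel. complex_of_real (gaussian x) * character (t * x)) = gaussian t"
    using s(2) by (simp add: gaussian_def power_mult_distrib)
  have "integrable lborel (\<lambda>x. std_normal_density (0 + s * x))"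
    using s by (intro lborel_integrable_real_affine) (auto intro: integrable_normal_density)
  then have "integrable lborel (\<lambda>x. complex_of_real (s * std_normal_density (s * x)))" by simp
  then have "integrable lborel (\<lambda>x::real. complex_of_real (gaussian x))"
    using s(1) by (simp add: dens)
  then show "integrable lborel (\<lambda>x. complex_of_real (gaussian x) * character (t * x))"
    by (rule Bochner_Integration.integrable_bound) (auto simp: norm_mult)
qed

text \<open>Both the Gaussian and the character factor over the coordinates, so the integral is a
  product of one-dimensional ones.\<close>

lemma gaussian_character_integral:
  fixes l :: "'a::euclidean_space"
  shows "integrable lborel (\<lambda>x. complex_of_real (gaussian x) * character (l \<bullet> x))"
    and "(LINT x|lborel. complex_of_real (gaussian x) * character (l \<bullet> x)) = gaussian l"
proof -
  interpret product_sigma_finite "\<lambda>_::'a. lborel :: real measure" ..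
  let ?S = "\<lambda>f. \<Sum>b\<in>Basis. f b *\<^sub>R (b::'a)"
  let ?h = "\<lambda>x. complex_of_real (gaussian x) * character (l \<bullet> x)"
  let ?g = "\<lambda>b x. complex_of_real (gaussian (x::real)) * character ((l \<bullet> b) * x)"
  have prod: "?h (?S f) = (\<Prod>b\<in>Basis. ?g b (f b))" for f
  proof -
    have comp: "?S f \<bullet> b = f b" if "b \<in> Basis" for b using that by simp
    have "gaussian (?S f) = (\<Prod>b\<in>Basis. gaussian (f b))"
      by (subst gaussian_prod) (auto intro!: prod.cong simp: comp)
    moreover have "character (l \<bullet> ?S f) = (\<Prod>b\<in>Basis. character ((l \<bullet> b) * f b))"
      by (simp add: inner_sum_right character_sum mult.commute)
    ultimately show ?thesis by (simp add: prod.distrib)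
  qed
  have S[measurable]: "?S \<in> (\<Pi>\<^sub>M b\<in>Basis. lborel) \<rightarrow>\<^sub>M borel" by measurable
  have "integrable (\<Pi>\<^sub>M b\<in>(Basis::'a set). lborel) (\<lambda>f. \<Prod>b\<in>Basis. ?g b (f b))"
    by (intro product_integrable_prod gaussian_character_integral_real) simp
  then show "integrable lborel ?h"
    by (subst lborel_eq, subst integrable_distr_eq) (simp_all only: prod S, measurable)
  have "(LINT x|lborel. ?h x) = (LINT f|(\<Pi>\<^sub>M b\<in>(Basis::'a set). lborel). ?h (?S f))"
    by (subst lborel_eq, subst integral_distr) auto
  also have "\<dots> = (\<Prod>b\<in>Basis. LINT x|lborel. ?g b x)"
    unfolding prod by (intro product_integral_prod gaussian_character_integral_real) simp
  also have "\<dots> = gaussian l"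
    by (simp add: gaussian_character_integral_real gaussian_prod[of l])
  finally show "(LINT x|lborel. ?h x) = gaussian l" .
qed

lemma integrable_gaussian: "integrable lborel (gaussian :: 'a::euclidean_space \<Rightarrow> real)"
  using gaussian_character_integral(1)[of "0::'a"] by (simp add: complex_of_real_integrable_eq)

lemma integral_gaussian: "(LINT x|lborel. gaussian (x::'a::euclidean_space)) = 1"
  using gaussian_character_integral(2)[of "0::'a"] by simp

lemma nn_integral_gaussian: "(\<integral>\<^sup>+x. ennreal (gaussian (x::'a::euclidean_space)) \<partial>lborel) = 1"
  by (subst nn_integral_eq_integral) (auto simp: integrable_gaussian integral_gaussian)

section \<open>Affine substitution and the Fourier transform of integrable functions\<close>

lemma integral_lborel_affine:
  fixes h :: "'a::euclidean_space \<Rightarrow> 'b::{banach,second_countable_topology}"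
  assumes [measurable]: "h \<in> borel_measurable borel" and c: "c \<noteq> 0"
  shows "(LINT x|lborel. h x) = \<bar>c\<bar> ^ DIM('a) *\<^sub>R (LINT x|lborel. h (t + c *\<^sub>R x))"
  by (subst lborel_affine[OF c, of t]) (simp add: integral_density integral_distr)

lemma integrable_lborel_affine:
  fixes h :: "'a::euclidean_space \<Rightarrow> 'b::{banach,second_countable_topology}"
  assumes h: "integrable lborel h" and c: "c \<noteq> 0"
  shows "integrable lborel (\<lambda>x. h (t + c *\<^sub>R x))"
proof -
  note [measurable] = borel_measurable_integrable[OF h]
  have "integrable (density (distr lborel borel (\<lambda>x. t + c *\<^sub>R x)) (\<lambda>_. ennreal (\<bar>c\<bar> ^ DIM('a)))) h"
    using h by (subst (asm) lborel_affine[OF c, of t]) simp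
  then have "integrable lborel (\<lambda>x. \<bar>c\<bar> ^ DIM('a) *\<^sub>R h (t + c *\<^sub>R x))"
    by (simp add: integrable_density integrable_distr_eq)
  from integrable_scaleR_right[OF this, of "inverse (\<bar>c\<bar> ^ DIM('a))"] c show ?thesis by simp
qed

text \<open>The Borel counterpart of \<open>fourier_transform\<close>: the analysis runs over
  \<open>lborel\<close>, where Fubini applies on the product measure, and is carried over to
  \<open>lebesgue\<close> at the end.\<close>

definition fourier :: "('a::euclidean_space \<Rightarrow> complex) \<Rightarrow> 'a \<Rightarrow> complex" where
  "fourier f l = (LINT x|lborel. f x * character (l \<bullet> x))"

lemma fourier_measurable [measurable]:
  assumes [measurable]: "f \<in> borel_measurable borel"
  shows "fourier f \<in> borel_measurable borel"
  unfolding fourier_def by measurable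

lemma norm_fourier_le: "norm (fourier f l) \<le> (LINT x|lborel. norm (f x))"
  unfolding fourier_def by (rule order_trans[OF integral_norm_bound]) (simp add: norm_mult)

text \<open>Applied to the transform of the transform, this upgrades almost everywhere inversion to
  points where the function is continuous.\<close>

lemma isCont_fourier:
  assumes f: "integrable lborel f"
  shows "isCont (fourier f) l"
proof (rule continuous_at_sequentiallyI)
  fix u assume u: "u \<longlonglongrightarrow> l"
  note [measurable] = borel_measurable_integrable[OF f]
  show "(\<lambda>n. fourier f (u n)) \<longlonglongrightarrow> fourier f l"
    unfolding fourier_def
  proof (rule integral_dominated_convergence[where w="\<lambda>x. norm (f x)"])
    show "AE x in lborel. (\<lambda>n. f x * character (u n \<bullet> x)) \<longlonglongrightarrow> f x * character (l \<bullet> x)"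
      unfolding character_def by (intro AE_I2 tendsto_intros tendsto_mult u tendsto_cis)
  qed (use f in \<open>auto simp: norm_mult\<close>)
qed

text \<open>Serves two kernels: a character, giving the duality of the transform, and the Gaussian
  kernel, giving the symmetry of smoothing.\<close>

lemma Fubini_bounded_kernel:
  fixes a :: "'a::euclidean_space \<Rightarrow> complex" and b :: "'b::euclidean_space \<Rightarrow> complex"
  assumes a: "integrable lborel a" and b: "integrable lborel b"
    and k[measurable]: "case_prod k \<in> borel_measurable (borel \<Otimes>\<^sub>M borel)" and bound: "\<And>x y. norm (k x y) \<le> C"
  shows "(LINT x|lborel. a x * (LINT y|lborel. b y * k x y)) = (LINT y|lborel. b y * (LINT x|lborel. a x * k x y))"
proof -
  note [measurable] = borel_measurable_integrable[OF a] borel_measurable_integrable[OF b]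
  have [measurable]: "case_prod k \<in> borel_measurable (lborel \<Otimes>\<^sub>M lborel)"
    using k by (simp cong: measurable_cong_sets sets_pair_measure_cong)
  have "integrable (lborel \<Otimes>\<^sub>M lborel) (\<lambda>(x, y). a x * b y)"
  proof (rule lborel_pair.Fubini_integrable)
    show "integrable lborel (\<lambda>x. LINT y|lborel. norm (case (x, y) of (x, y) \<Rightarrow> a x * b y))"
      using a by (simp add: norm_mult)
    show "AE x in lborel. integrable lborel (\<lambda>y. case (x, y) of (x, y) \<Rightarrow> a x * b y)"
      using b by simp
  qed measurable
  then have "integrable (lborel \<Otimes>\<^sub>M lborel) (\<lambda>p. C * norm (case p of (x, y) \<Rightarrow> a x * b y))"
    by (intro integrable_mult_right integrable_norm)
  then have int: "integrable (lborel \<Otimes>\<^sub>M lborel) (\<lambda>(x, y). a x * b y * k x y)"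
  proof (rule Bochner_Integration.integrable_bound)
    have "norm (a x * b y * k x y) \<le> norm (C * norm (a x * b y))" for x y
    proof -
      have "norm (a x * b y * k x y) \<le> norm (a x * b y) * C"
        unfolding norm_mult[of "a x * b y"] by (intro mult_left_mono bound norm_ge_zero)
      then show ?thesis by (simp add: mult.commute)
    qed
    then show "AE p in lborel \<Otimes>\<^sub>M lborel. norm (case p of (x, y) \<Rightarrow> a x * b y * k x y)
        \<le> norm (C * norm (case p of (x, y) \<Rightarrow> a x * b y))"
      by (intro AE_I2) (simp split: prod.split)
  qed measurable
  have "(LINT x|lborel. a x * (LINT y|lborel. b y * k x y)) = (LINT x|lborel. LINT y|lborel. a x * b y * k x y)"
    by (simp add: mult.assoc)
  also have "\<dots> = (LINT y|lborel. LINT x|lborel. a x * b y * k x y)"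
    using lborel_pair.Fubini_integral[OF int] by simp
  also have "\<dots> = (LINT y|lborel. LINT x|lborel. b y * (a x * k x y))"
    by (simp only: mult.assoc mult.left_commute)
  finally show ?thesis by simp
qed

lemma fourier_duality:
  fixes f g :: "'a::euclidean_space \<Rightarrow> complex"
  assumes "integrable lborel f" "integrable lborel g"
  shows "(LINT l|lborel. fourier f l * g l) = (LINT x|lborel. f x * fourier g x)"
  using Fubini_bounded_kernel[OF assms(2,1), of "\<lambda>l x. character (l \<bullet> x)" 1]
  by (simp add: fourier_def mult.commute inner_commute)

section \<open>The Gaussian kernel as an approximate identity\<close>

definition gaussian_kernel :: "real \<Rightarrow> 'a::euclidean_space \<Rightarrow> real" where
  "gaussian_kernel \<epsilon> u = gaussian ((1 / \<epsilon>) *\<^sub>R u) / \<epsilon> ^ DIM('a)"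

lemma gaussian_kernel_measurable [measurable]: "gaussian_kernel \<epsilon> \<in> borel_measurable borel"
  unfolding gaussian_kernel_def by measurable

lemma gaussian_kernel_bound:
  "0 < \<epsilon> \<Longrightarrow> norm (complex_of_real (gaussian_kernel \<epsilon> (u::'a::euclidean_space))) \<le> 1 / \<epsilon> ^ DIM('a)"
  by (simp add: gaussian_kernel_def norm_divide norm_power divide_right_mono gaussian_le_one)

lemma gaussian_kernel_commute: "gaussian_kernel \<epsilon> (x - y) = gaussian_kernel \<epsilon> (y - x)"
proof -
  have "(1 / \<epsilon>) *\<^sub>R (x - y) = - ((1 / \<epsilon>) *\<^sub>R (y - x))" by (simp add: scaleR_right_diff_distrib)
  then show ?thesis unfolding gaussian_kernel_def by (simp only: gaussian_minus)
qed

definition gaussian_smoothing :: "real \<Rightarrow> ('a::euclidean_space \<Rightarrow> complex) \<Rightarrow> 'a \<Rightarrow> complex" where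
  "gaussian_smoothing \<epsilon> f x = (LINT y|lborel. f y * complex_of_real (gaussian_kernel \<epsilon> (y - x)))"

lemma gaussian_smoothing_measurable [measurable]:
  assumes [measurable]: "f \<in> borel_measurable borel"
  shows "gaussian_smoothing \<epsilon> f \<in> borel_measurable borel"
  unfolding gaussian_smoothing_def by measurable

lemma integrable_gaussian_scaled:
  "\<epsilon> \<noteq> 0 \<Longrightarrow> integrable lborel (\<lambda>l. gaussian (\<epsilon> *\<^sub>R (l::'a::euclidean_space)))"
  using integrable_lborel_affine[OF integrable_gaussian, of \<epsilon> 0] by simp

lemma integrable_mult_bounded:
  fixes g :: "'a::euclidean_space \<Rightarrow> complex"
  assumes f: "integrable lborel f" and [measurable]: "g \<in> borel_measurable borel" and bound: "\<And>x. norm (g x) \<le> C"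
  shows "integrable lborel (\<lambda>x. g x * f x)"
proof (rule Bochner_Integration.integrable_bound[where f="\<lambda>x. C * norm (f x)"])
  note [measurable] = borel_measurable_integrable[OF f]
  show "(\<lambda>x. g x * f x) \<in> borel_measurable lborel" by measurable
  have "0 \<le> C" using bound norm_ge_zero order_trans by blast
  then show "AE x in lborel. norm (g x * f x) \<le> norm (C * norm (f x))"
    by (intro AE_I2) (simp add: norm_mult abs_mult bound mult_right_mono)
qed (use f in simp)

text \<open>Modulation by \<open>x\<close> becomes translation by \<open>x\<close> and dilation by
  \<open>\<epsilon>\<close> becomes the inverse dilation with its Jacobian, so self-duality of the
  Gaussian yields the kernel.\<close>

lemma fourier_scaled_gaussian:
  fixes x y :: "'a::euclidean_space"
  assumes \<epsilon>: "0 < \<epsilon>"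
  shows "fourier (\<lambda>l. complex_of_real (gaussian (\<epsilon> *\<^sub>R l)) * character (- (l \<bullet> x))) y = gaussian_kernel \<epsilon> (y - x)"
proof -
  let ?k = "(1 / \<epsilon>) *\<^sub>R (y - x)"
  let ?h = "\<lambda>u. complex_of_real (gaussian u) * character (?k \<bullet> u)"
  have "fourier (\<lambda>l. complex_of_real (gaussian (\<epsilon> *\<^sub>R l)) * character (- (l \<bullet> x))) y
      = (LINT l|lborel. ?h (0 + \<epsilon> *\<^sub>R l))"
    unfolding fourier_def
  proof (rule Bochner_Integration.integral_cong[OF refl])
    fix l
    have "character (?k \<bullet> (0 + \<epsilon> *\<^sub>R l)) = character (- (l \<bullet> x) + y \<bullet> l)"
      using \<epsilon> by (simp add: inner_diff_left inner_commute[of l x])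
    then show "complex_of_real (gaussian (\<epsilon> *\<^sub>R l)) * character (- (l \<bullet> x)) * character (y \<bullet> l) = ?h (0 + \<epsilon> *\<^sub>R l)"
      by (simp only: character_add) simp
  qed
  moreover have "complex_of_real (gaussian ?k) = \<epsilon> ^ DIM('a) *\<^sub>R (LINT l|lborel. ?h (0 + \<epsilon> *\<^sub>R l))"
  proof -
    have [measurable]: "?h \<in> borel_measurable borel" by measurable
    have "integral\<^sup>L lborel ?h = \<bar>\<epsilon>\<bar> ^ DIM('a) *\<^sub>R (LINT l|lborel. ?h (0 + \<epsilon> *\<^sub>R l))"
      using \<epsilon> by (intro integral_lborel_affine) auto
    then show ?thesis using \<epsilon> by (simp only: gaussian_character_integral(2) abs_of_pos)
  qed
  ultimately show ?thesis using \<epsilon> by (simp add: gaussian_kernel_def scaleR_conv_of_real)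
qed

text \<open>The Gaussian factor makes the inversion integral converge absolutely although
  \<open>fourier f\<close> is only known to be bounded; duality then moves the transform onto that
  factor.\<close>

lemma gaussian_smoothing_fourier:
  fixes f :: "'a::euclidean_space \<Rightarrow> complex"
  assumes f: "integrable lborel f" and \<epsilon>: "0 < \<epsilon>"
  shows "(LINT l|lborel. fourier f l * (complex_of_real (gaussian (\<epsilon> *\<^sub>R l)) * character (- (l \<bullet> x)))) = gaussian_smoothing \<epsilon> f x"
proof -
  have "integrable lborel (\<lambda>l. character (- (l \<bullet> x)) * complex_of_real (gaussian (\<epsilon> *\<^sub>R l)))"
    using \<epsilon> by (intro integrable_mult_bounded[where C=1] integrable_of_real integrable_gaussian_scaled) auto
  then have "integrable lborel (\<lambda>l. complex_of_real (gaussian (\<epsilon> *\<^sub>R l)) * character (- (l \<bullet> x)))"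
    by (simp add: mult.commute)
  from fourier_duality[OF f this] show ?thesis
    by (simp add: gaussian_smoothing_def fourier_scaled_gaussian[OF \<epsilon>])
qed

text \<open>After the substitution the weight is a fixed probability density, and
  \<open>\<epsilon>\<close> occurs only inside \<open>f\<close>: continuity and boundedness of
  \<open>f\<close> then suffice for the limit.\<close>

lemma gaussian_smoothing_average:
  fixes f :: "'a::euclidean_space \<Rightarrow> complex"
  assumes [measurable]: "f \<in> borel_measurable borel" and \<epsilon>: "0 < \<epsilon>"
  shows "gaussian_smoothing \<epsilon> f x = (LINT z|lborel. f (x + \<epsilon> *\<^sub>R z) * complex_of_real (gaussian z))"
  unfolding gaussian_smoothing_def
  using \<epsilon> by (subst integral_lborel_affine[of _ \<epsilon> x])
    (auto simp: gaussian_kernel_def scaleR_conv_of_real)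

text \<open>The kernel is even, so the smoothing can pass from a merely integrable factor to the
  other one.\<close>

lemma gaussian_smoothing_symmetric:
  fixes f g :: "'a::euclidean_space \<Rightarrow> complex"
  assumes f: "integrable lborel f" and g: "integrable lborel g" and \<epsilon>: "0 < \<epsilon>"
  shows "(LINT x|lborel. g x * gaussian_smoothing \<epsilon> f x) = (LINT x|lborel. f x * gaussian_smoothing \<epsilon> g x)"
  unfolding gaussian_smoothing_def
  using Fubini_bounded_kernel[OF g f _ gaussian_kernel_bound[OF \<epsilon>], of "\<lambda>x y. y - x"]
  by (simp add: gaussian_kernel_commute)

lemma norm_gaussian_smoothing_le:
  fixes \<psi> :: "'a::euclidean_space \<Rightarrow> complex"
  assumes [measurable]: "\<psi> \<in> borel_measurable borel" and bound: "\<And>x. norm (\<psi> x) \<le> C" and \<epsilon>: "0 < \<epsilon>"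
  shows "norm (gaussian_smoothing \<epsilon> \<psi> x) \<le> C"
proof -
  have "norm (gaussian_smoothing \<epsilon> \<psi> x) \<le> (LINT z|lborel. norm (\<psi> (x + \<epsilon> *\<^sub>R z) * complex_of_real (gaussian z)))"
    unfolding gaussian_smoothing_average[OF assms(1) \<epsilon>] by (rule integral_norm_bound)
  also have "\<dots> \<le> (LINT z|lborel. C * gaussian (z::'a))"
  proof (rule integral_mono)
    show "integrable lborel (\<lambda>z. norm (\<psi> (x + \<epsilon> *\<^sub>R z) * complex_of_real (gaussian z)))"
      by (intro integrable_norm integrable_mult_bounded[where C=C] integrable_of_real integrable_gaussian bound) measurable
  qed (auto simp: norm_mult bound mult_right_mono integrable_gaussian)
  also have "\<dots> = C" by (simp add: integral_gaussian)
  finally show ?thesis .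
qed

lemma gaussian_smoothing_tendsto:
  fixes \<psi> :: "'a::euclidean_space \<Rightarrow> complex"
  assumes cont: "continuous_on UNIV \<psi>" and bound: "\<And>x. norm (\<psi> x) \<le> C"
    and \<epsilon>: "\<And>n. 0 < \<epsilon> n" "\<epsilon> \<longlonglongrightarrow> 0"
  shows "(\<lambda>n. gaussian_smoothing (\<epsilon> n) \<psi> x) \<longlonglongrightarrow> \<psi> x"
proof -
  have [measurable]: "\<psi> \<in> borel_measurable borel" by (rule borel_measurable_continuous_onI[OF cont])
  have "(\<lambda>n. LINT z|lborel. \<psi> (x + \<epsilon> n *\<^sub>R z) * complex_of_real (gaussian z))
      \<longlonglongrightarrow> (LINT z|lborel. \<psi> x * complex_of_real (gaussian (z::'a)))"
  proof (rule integral_dominated_convergence[where w="\<lambda>z::'a. C * gaussian z"])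
    show "AE z in lborel. (\<lambda>n. \<psi> (x + \<epsilon> n *\<^sub>R z) * complex_of_real (gaussian z)) \<longlonglongrightarrow> \<psi> x * complex_of_real (gaussian z)"
    proof (intro AE_I2 tendsto_mult tendsto_const)
      fix z
      have "(\<lambda>n. x + \<epsilon> n *\<^sub>R z) \<longlonglongrightarrow> x + 0 *\<^sub>R z" by (intro tendsto_intros \<epsilon>)
      moreover have "isCont \<psi> x" using cont by (simp add: continuous_on_eq_continuous_at)
      ultimately show "(\<lambda>n. \<psi> (x + \<epsilon> n *\<^sub>R z)) \<longlonglongrightarrow> \<psi> x"
        using isCont_tendsto_compose[of x \<psi>] by simp
    qed
  qed (auto simp: integrable_gaussian norm_mult bound mult_right_mono)
  then show ?thesis by (simp add: gaussian_smoothing_average \<epsilon>(1) integral_gaussian)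
qed

text \<open>Continuous functions converging almost everywhere are not by themselves dominated; the
  common bound \<open>B\<close> is the majorant that the later limits under the integral
  require.\<close>

lemma continuous_approximation:
  fixes h :: "'a::euclidean_space \<Rightarrow> complex" and B :: "'a \<Rightarrow> real"
  assumes h: "h \<in> borel_measurable borel" and B: "continuous_on UNIV B" "\<And>x. 0 < B x" and hB: "\<And>x. norm (h x) \<le> B x"
  obtains g where "\<And>n::nat. continuous_on UNIV (g n)" "\<And>n x. norm (g n x) \<le> B x" "AE x in lborel. (\<lambda>n. g n x) \<longlonglongrightarrow> h x"
proof -
  have "h \<in> borel_measurable lebesgue" using h by (simp add: measurable_completion)
  then have "h measurable_on UNIV"
    using lebesgue_measurable_imp_measurable_on[of h UNIV] by simp
  then obtain N g where N: "negligible N" and g: "\<And>n. continuous_on UNIV (g n)"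
    and lim: "\<And>x. x \<notin> N \<Longrightarrow> (\<lambda>n. g n x) \<longlonglongrightarrow> h x"
    unfolding measurable_on_def by auto
  \<comment> \<open>Radial truncation: values of norm above \<open>B x\<close> are scaled back to
    norm \<open>B x\<close> and the others are kept. It is continuous and fixes \<open>h x\<close>,
    so the limit survives.\<close>
  define g' where "g' n x = (B x / max (B x) (norm (g n x))) *\<^sub>R g n x" for n x
  have pos: "0 < max (B x) r" for x r using B(2)[of x] by (simp add: less_max_iff_disj)
  show ?thesis
  proof (rule that[of g'])
    show "continuous_on UNIV (g' n)" for n
      unfolding g'_def using pos by (intro continuous_intros B g) (metis less_irrefl)
    show "norm (g' n x) \<le> B x" for n x
    proof -
      have "norm (g' n x) = B x * (norm (g n x) / max (B x) (norm (g n x)))"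
        using B(2)[of x] pos[of x "norm (g n x)"] by (simp add: g'_def)
      also have "\<dots> \<le> B x * 1"
        using B(2)[of x] pos[of x "norm (g n x)"] by (intro mult_left_mono) auto
      finally show ?thesis by simp
    qed
    have conv: "(\<lambda>n. g' n x) \<longlonglongrightarrow> h x" if "x \<notin> N" for x
    proof -
      have "(\<lambda>n. g' n x) \<longlonglongrightarrow> (B x / max (B x) (norm (h x))) *\<^sub>R h x"
        unfolding g'_def using pos[of x "norm (h x)"] by (intro tendsto_intros lim that) auto
      moreover have "max (B x) (norm (h x)) = B x" using hB[of x] by simp
      ultimately show ?thesis using B(2)[of x] by simp
    qed
    have "N \<in> null_sets lebesgue" using N by (simp add: negligible_iff_null_sets)
    then have "AE x in lebesgue. (\<lambda>n. g' n x) \<longlonglongrightarrow> h x"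
      by (rule AE_I') (use conv in auto)
    then show "AE x in lborel. (\<lambda>n. g' n x) \<longlonglongrightarrow> h x" by (simp add: AE_completion_iff)
  qed
qed

subsection \<open>Fourier inversion and the Plancherel formula\<close>

text \<open>The shift by \<open>Suc\<close> keeps every width positive; index 0 would otherwise give
  \<open>inverse 0 = 0\<close>.\<close>

abbreviation width :: "nat \<Rightarrow> real" where "width n \<equiv> inverse (real (Suc n))"

lemma gaussian_width_tendsto:
  fixes l :: "'a::euclidean_space"
  shows "(\<lambda>n. gaussian (width n *\<^sub>R l)) \<longlonglongrightarrow> 1"
proof -
  have "isCont gaussian (0::'a)"
    using continuous_on_gaussian[of "UNIV::'a set"] by (simp add: continuous_on_eq_continuous_at)
  moreover have "(\<lambda>n. width n *\<^sub>R l) \<longlonglongrightarrow> 0 *\<^sub>R l"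
    by (intro tendsto_intros LIMSEQ_inverse_real_of_nat)
  ultimately have "(\<lambda>n. gaussian (width n *\<^sub>R l)) \<longlonglongrightarrow> gaussian (0::'a)"
    using isCont_tendsto_compose[of "0::'a" gaussian] by simp
  then show ?thesis by simp
qed

lemma gaussian_smoothing_pairing_tendsto:
  fixes f \<psi> :: "'a::euclidean_space \<Rightarrow> complex"
  assumes f: "integrable lborel f" and cont: "continuous_on UNIV \<psi>" and bound: "\<And>x. norm (\<psi> x) \<le> C"
  shows "(\<lambda>n. LINT x|lborel. f x * gaussian_smoothing (width n) \<psi> x) \<longlonglongrightarrow> (LINT x|lborel. f x * \<psi> x)"
proof -
  have [measurable]: "\<psi> \<in> borel_measurable borel" by (rule borel_measurable_continuous_onI[OF cont])
  note [measurable] = borel_measurable_integrable[OF f]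
  show ?thesis
  proof (rule integral_dominated_convergence[where w="\<lambda>x. norm (f x) * C"])
    show "AE x in lborel. (\<lambda>n. f x * gaussian_smoothing (width n) \<psi> x) \<longlonglongrightarrow> f x * \<psi> x"
      by (intro AE_I2 tendsto_intros gaussian_smoothing_tendsto[OF cont bound] LIMSEQ_inverse_real_of_nat) simp
    show "AE x in lborel. norm (f x * gaussian_smoothing (width n) \<psi> x) \<le> norm (f x) * C" for n
      unfolding norm_mult
      by (intro AE_I2 mult_left_mono norm_gaussian_smoothing_le bound norm_ge_zero) auto
  qed (use f in auto)
qed

text \<open>Damping \<open>fourier f\<close> by a Gaussian amounts to smoothing \<open>f\<close>, and the smoothing can be moved
  onto the test function \<open>\<psi>\<close>.\<close>

lemma fourier_inversion_weak:
  fixes f \<psi> :: "'a::euclidean_space \<Rightarrow> complex"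
  assumes f: "integrable lborel f" and Ff: "integrable lborel (fourier f)"
    and cont: "continuous_on UNIV \<psi>" and bound: "\<And>x. norm (\<psi> x) \<le> C" and \<psi>: "integrable lborel \<psi>"
  shows "(LINT x|lborel. f x * \<psi> x) = (LINT x|lborel. fourier (fourier f) (- x) * \<psi> x)"
proof (rule LIMSEQ_unique)
  note [measurable] = borel_measurable_integrable[OF f] borel_measurable_integrable[OF Ff] borel_measurable_integrable[OF \<psi>]
  let ?M = "LINT l|lborel. norm (fourier f l)"
  show "(\<lambda>n. LINT x|lborel. f x * gaussian_smoothing (width n) \<psi> x) \<longlonglongrightarrow> (LINT x|lborel. f x * \<psi> x)"
    by (rule gaussian_smoothing_pairing_tendsto[OF f cont bound])
  have "(\<lambda>n. LINT x|lborel. \<psi> x * gaussian_smoothing (width n) f x) \<longlonglongrightarrow> (LINT x|lborel. \<psi> x * fourier (fourier f) (- x))"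
  proof (rule integral_dominated_convergence[where w="\<lambda>x. norm (\<psi> x) * ?M"])
    \<comment> \<open>Here integrability of \<open>fourier f\<close> enters: it dominates the damped
      integrands, so the Gaussian tends to 1 under the integral and the smoothings converge
      everywhere, uniformly bounded by \<open>?M\<close>.\<close>
    have ptw: "(\<lambda>n. gaussian_smoothing (width n) f x) \<longlonglongrightarrow> fourier (fourier f) (- x)" for x
    proof -
      have "(\<lambda>n. LINT l|lborel. fourier f l * (complex_of_real (gaussian (width n *\<^sub>R l)) * character (- (l \<bullet> x))))
        \<longlonglongrightarrow> (LINT l|lborel. fourier f l * (complex_of_real 1 * character (- (l \<bullet> x))))"
      proof (rule integral_dominated_convergence[where w="\<lambda>l. norm (fourier f l)"])
        show "AE l in lborel. (\<lambda>n. fourier f l * (complex_of_real (gaussian (width n *\<^sub>R l)) * character (- (l \<bullet> x))))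
          \<longlonglongrightarrow> fourier f l * (complex_of_real 1 * character (- (l \<bullet> x)))"
          by (intro AE_I2 tendsto_intros gaussian_width_tendsto)
        show "AE l in lborel. norm (fourier f l * (complex_of_real (gaussian (width n *\<^sub>R l)) * character (- (l \<bullet> x)))) \<le> norm (fourier f l)" for n
          by (intro AE_I2) (simp add: norm_mult mult_left_le gaussian_le_one)
      qed (use Ff in auto)
      then show ?thesis
        by (simp add: gaussian_smoothing_fourier[OF f] fourier_def[of "fourier f"] inner_commute)
    qed
    show "AE x in lborel. (\<lambda>n. \<psi> x * gaussian_smoothing (width n) f x) \<longlonglongrightarrow> \<psi> x * fourier (fourier f) (- x)"
      by (intro AE_I2 tendsto_intros ptw)
    show "AE x in lborel. norm (\<psi> x * gaussian_smoothing (width n) f x) \<le> norm (\<psi> x) * ?M" for n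
    proof (intro AE_I2)
      fix x
      have "norm (gaussian_smoothing (width n) f x)
        \<le> (LINT l|lborel. norm (fourier f l * (complex_of_real (gaussian (width n *\<^sub>R l)) * character (- (l \<bullet> x)))))"
        by (subst gaussian_smoothing_fourier[OF f, symmetric]) (auto intro: integral_norm_bound)
      also have "\<dots> \<le> ?M"
      proof (rule integral_mono)
        have "integrable lborel (\<lambda>l. (complex_of_real (gaussian (width n *\<^sub>R l)) * character (- (l \<bullet> x))) * fourier f l)"
          by (rule integrable_mult_bounded[where C=1, OF Ff]) (auto simp: norm_mult gaussian_le_one)
        then show "integrable lborel (\<lambda>l. norm (fourier f l * (complex_of_real (gaussian (width n *\<^sub>R l)) * character (- (l \<bullet> x)))))"
          by (simp add: mult_ac)
      qed (use Ff in \<open>auto simp: norm_mult mult_left_le gaussian_le_one\<close>)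
      finally show "norm (\<psi> x * gaussian_smoothing (width n) f x) \<le> norm (\<psi> x) * ?M"
        by (simp add: norm_mult mult_left_mono)
    qed
  qed (use \<psi> in auto)
  then show "(\<lambda>n. LINT x|lborel. f x * gaussian_smoothing (width n) \<psi> x) \<longlonglongrightarrow> (LINT x|lborel. fourier (fourier f) (- x) * \<psi> x)"
    by (simp add: gaussian_smoothing_symmetric[OF f \<psi>] mult.commute[of "fourier (fourier f) _"])
qed

lemma cnj_measurable [measurable]: "cnj \<in> borel_measurable borel"
  by (intro borel_measurable_continuous_onI continuous_intros)

lemma sgn_complex_measurable [measurable]: "(sgn :: complex \<Rightarrow> complex) \<in> borel_measurable borel"
  unfolding sgn_eq[abs_def] by measurable

lemma mult_cnj_sgn: "z * cnj (sgn z) = complex_of_real (norm z)"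
proof (cases "z = 0")
  case False
  have "z * cnj (sgn z) = (z * cnj z) / norm z" by (simp add: sgn_eq)
  also have "\<dots> = norm z" using False by (simp add: complex_norm_square[symmetric] power2_eq_square)
  finally show ?thesis .
qed simp

text \<open>The weak form tests \<open>f\<close> only against continuous functions; approximating the conjugated phase of
  the difference \<open>h\<close>, damped by a Gaussian, turns it into \<open>\<integral> \<bar>h\<bar> gaussian = 0\<close>.\<close>

theorem fourier_inversion_AE:
  fixes f :: "'a::euclidean_space \<Rightarrow> complex"
  assumes f: "integrable lborel f" and Ff: "integrable lborel (fourier f)"
  shows "AE x in lborel. f x = fourier (fourier f) (- x)"
proof -
  note [measurable] = borel_measurable_integrable[OF f] borel_measurable_integrable[OF Ff]
  define h where "h x = f x - fourier (fourier f) (- x)" for x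
  have [measurable]: "h \<in> borel_measurable borel" unfolding h_def by measurable
  \<comment> \<open>One side of the inversion formula is integrable but possibly unbounded, the
    other bounded but possibly not integrable. A test function below the Gaussian is both bounded
    and integrable, so it pairs with each.\<close>
  have int: "integrable lborel (\<lambda>x. f x * g x)" "integrable lborel (\<lambda>x. fourier (fourier f) (- x) * g x)"
    if [measurable]: "g \<in> borel_measurable borel" and g: "\<And>x. norm (g x) \<le> gaussian x" for g
  proof -
    have "norm (g x) \<le> 1" for x using g[of x] gaussian_le_one[of x] by linarith
    then have "integrable lborel (\<lambda>x. g x * f x)" by (intro integrable_mult_bounded[OF f]) auto
    then show "integrable lborel (\<lambda>x. f x * g x)" by (simp add: mult.commute)
    have "integrable lborel g"
      by (rule Bochner_Integration.integrable_bound[OF integrable_gaussian]) (use g in auto)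
    then show "integrable lborel (\<lambda>x. fourier (fourier f) (- x) * g x)"
      by (rule integrable_mult_bounded) (auto intro: norm_fourier_le)
  qed
  have hg: "integrable lborel (\<lambda>x. norm (h x) * gaussian x)"
  proof -
    have "integrable lborel (\<lambda>x. f x * complex_of_real (gaussian x) - fourier (fourier f) (- x) * complex_of_real (gaussian x))"
      by (intro Bochner_Integration.integrable_diff int) auto
    then have "integrable lborel (\<lambda>x. norm (h x * complex_of_real (gaussian x)))"
      by (intro integrable_norm) (simp add: h_def left_diff_distrib)
    then show ?thesis by (simp add: norm_mult)
  qed
  obtain g where g: "\<And>n::nat. continuous_on UNIV (g n)" "\<And>n x. norm (g n x) \<le> gaussian x"
    and lim: "AE x in lborel. (\<lambda>n. g n x) \<longlonglongrightarrow> cnj (sgn (h x)) * complex_of_real (gaussian x)"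
  proof (rule continuous_approximation[of "\<lambda>x. cnj (sgn (h x)) * complex_of_real (gaussian x)" gaussian])
    show "(\<lambda>x. cnj (sgn (h x)) * complex_of_real (gaussian x)) \<in> borel_measurable borel" by measurable
    show "norm (cnj (sgn (h x)) * complex_of_real (gaussian x)) \<le> gaussian x" for x
      by (simp add: norm_mult norm_sgn)
  qed (auto intro: continuous_on_gaussian gaussian_pos)
  have [measurable]: "g n \<in> borel_measurable borel" for n by (rule borel_measurable_continuous_onI[OF g(1)])
  have zero: "(LINT x|lborel. h x * g n x) = 0" for n
  proof -
    have "integrable lborel (g n)"
      by (rule Bochner_Integration.integrable_bound[OF integrable_gaussian]) (use g in auto)
    moreover have "norm (g n x) \<le> 1" for x using g(2)[of n x] gaussian_le_one[of x] by linarith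
    ultimately have "(LINT x|lborel. f x * g n x) = (LINT x|lborel. fourier (fourier f) (- x) * g n x)"
      by (intro fourier_inversion_weak[OF f Ff g(1)])
    then show ?thesis
      using int[of "g n"] g(2) by (simp add: h_def left_diff_distrib)
  qed
  have "(\<lambda>n. LINT x|lborel. h x * g n x) \<longlonglongrightarrow> (LINT x|lborel. h x * (cnj (sgn (h x)) * complex_of_real (gaussian x)))"
  proof (rule integral_dominated_convergence[where w="\<lambda>x. norm (h x) * gaussian x"])
    show "AE x in lborel. (\<lambda>n. h x * g n x) \<longlonglongrightarrow> h x * (cnj (sgn (h x)) * complex_of_real (gaussian x))"
      using lim by eventually_elim (intro tendsto_intros)
  qed (use hg g(2) in \<open>auto simp: norm_mult mult_left_mono\<close>)
  then have "(LINT x|lborel. h x * (cnj (sgn (h x)) * complex_of_real (gaussian x))) = 0"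
    unfolding zero LIMSEQ_const_iff by (rule sym)
  moreover have "h x * (cnj (sgn (h x)) * complex_of_real (gaussian x)) = complex_of_real (norm (h x) * gaussian x)" for x
    by (simp add: mult_cnj_sgn flip: mult.assoc)
  ultimately have "(LINT x|lborel. norm (h x) * gaussian x) = 0"
    by (simp only: integral_complex_of_real of_real_eq_0_iff)
  then have "AE x in lborel. norm (h x) * gaussian x = 0"
    using integral_nonneg_eq_0_iff_AE[OF hg] by simp
  then show ?thesis
    by eventually_elim (simp add: h_def gaussian_pos[THEN less_imp_neq, symmetric])
qed

section \<open>Bessel's inequality and the Plancherel formula\<close>

lemma fourier_pairing_damped:
  fixes f g :: "'a::euclidean_space \<Rightarrow> complex"
  assumes f: "integrable lborel f" and g: "integrable lborel g" and \<epsilon>: "0 < \<epsilon>"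
  shows "(LINT l|lborel. fourier f l * (cnj (fourier g l) * complex_of_real (gaussian (\<epsilon> *\<^sub>R l))))
    = (LINT y|lborel. f y * cnj (gaussian_smoothing \<epsilon> g y))"
proof -
  note [measurable] = borel_measurable_integrable[OF g]
  let ?h = "\<lambda>l. cnj (fourier g l) * complex_of_real (gaussian (\<epsilon> *\<^sub>R l))"
  \<comment> \<open>The conjugate transform is only bounded; the Gaussian factor supplies the
    integrability that duality asks for.\<close>
  have "integrable lborel ?h"
    using \<epsilon> by (intro integrable_mult_bounded[where C="LINT x|lborel. norm (g x)"] integrable_of_real integrable_gaussian_scaled)
      (auto intro: norm_fourier_le)
  moreover have "fourier ?h y = cnj (gaussian_smoothing \<epsilon> g y)" for y
    unfolding gaussian_smoothing_fourier[OF g \<epsilon>, symmetric] Bochner_Integration.integral_cnj[symmetric] fourier_def[of ?h]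
    by (simp add: inner_commute mult.assoc del: Bochner_Integration.integral_cnj)
  ultimately show ?thesis using fourier_duality[OF f] by simp
qed

text \<open>A non-integrable function has integral 0 by convention, so the bound persists and
  integrability of the shifted products in \<open>damped_bessel\<close> need not be checked.\<close>

lemma ennreal_norm_integral_le:
  fixes h :: "'a \<Rightarrow> 'b::{banach,second_countable_topology}"
  shows "ennreal (norm (integral\<^sup>L M h)) \<le> (\<integral>\<^sup>+x. ennreal (norm (h x)) \<partial>M)"
  by (cases "integrable M h") (auto intro: integral_norm_bound_ennreal simp: not_integrable_integral_eq)

text \<open>The damped square integral is the pairing of \<open>f\<close> with its own smoothing, an
  average over \<open>z\<close> of pairings of \<open>f\<close> with its shift by
  \<open>\<epsilon> *\<^sub>R z\<close>. Shifts preserve the square integral, so the pointwise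
  inequality between \<open>a * b\<close> and \<open>(a\<^sup>2 + b\<^sup>2) / 2\<close> already
  gives the sharp constant.\<close>

lemma damped_bessel:
  fixes f :: "'a::euclidean_space \<Rightarrow> complex"
  assumes f: "integrable lborel f" and f2: "integrable lborel (\<lambda>x. (norm (f x))\<^sup>2)" and \<epsilon>: "0 < \<epsilon>"
  shows "integrable lborel (\<lambda>l. (norm (fourier f l))\<^sup>2 * gaussian (\<epsilon> *\<^sub>R l))"
    and "(LINT l|lborel. (norm (fourier f l))\<^sup>2 * gaussian (\<epsilon> *\<^sub>R l)) \<le> (LINT x|lborel. (norm (f x))\<^sup>2)"
proof -
  note [measurable] = borel_measurable_integrable[OF f]
  let ?M = "LINT x|lborel. norm (f x)" and ?I = "LINT x|lborel. (norm (f x))\<^sup>2"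
  let ?A = "LINT l|lborel. (norm (fourier f l))\<^sup>2 * gaussian (\<epsilon> *\<^sub>R l)"
  show "integrable lborel (\<lambda>l. (norm (fourier f l))\<^sup>2 * gaussian (\<epsilon> *\<^sub>R l))"
  proof (rule Bochner_Integration.integrable_bound[where f="\<lambda>l. ?M\<^sup>2 * gaussian (\<epsilon> *\<^sub>R l)"])
    show "AE l in lborel. norm ((norm (fourier f l))\<^sup>2 * gaussian (\<epsilon> *\<^sub>R l)) \<le> norm (?M\<^sup>2 * gaussian (\<epsilon> *\<^sub>R l))"
      by (intro AE_I2) (simp add: mult_right_mono power_mono norm_fourier_le)
  qed (use \<epsilon> in \<open>auto intro: integrable_gaussian_scaled\<close>)
  have half: "(\<integral>\<^sup>+y. ennreal ((norm (f y))\<^sup>2 / 2) \<partial>lborel) = ennreal (?I / 2)"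
    using f2 by (subst nn_integral_eq_integral) auto
  have inner: "(\<integral>\<^sup>+y. ennreal (((norm (f y))\<^sup>2 + (norm (f (y + c)))\<^sup>2) / 2) \<partial>lborel) = ennreal ?I" for c
  proof -
    have "(\<integral>\<^sup>+y. ennreal (((norm (f y))\<^sup>2 + (norm (f (y + c)))\<^sup>2) / 2) \<partial>lborel)
        = (\<integral>\<^sup>+y. ennreal ((norm (f y))\<^sup>2 / 2) + ennreal ((norm (f (c + y)))\<^sup>2 / 2) \<partial>lborel)"
      by (intro nn_integral_cong) (simp add: add_divide_distrib add.commute flip: ennreal_plus)
    also have "\<dots> = (\<integral>\<^sup>+y. ennreal ((norm (f y))\<^sup>2 / 2) \<partial>lborel) + (\<integral>\<^sup>+y. ennreal ((norm (f (c + y)))\<^sup>2 / 2) \<partial>lborel)"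
      by (intro nn_integral_add) measurable
    also have "(\<integral>\<^sup>+y. ennreal ((norm (f (c + y)))\<^sup>2 / 2) \<partial>lborel) = (\<integral>\<^sup>+y. ennreal ((norm (f y))\<^sup>2 / 2) \<partial>lborel)"
      by (rule nn_integral_lborel_translation[where f="\<lambda>y. ennreal ((norm (f y))\<^sup>2 / 2)"]) measurable
    finally show ?thesis unfolding half by (simp flip: ennreal_plus)
  qed
  have "complex_of_real ?A = (LINT l|lborel. fourier f l * (cnj (fourier f l) * complex_of_real (gaussian (\<epsilon> *\<^sub>R l))))"
    unfolding integral_complex_of_real[symmetric]
    by (intro Bochner_Integration.integral_cong refl) (simp add: complex_norm_square del: of_real_power flip: mult.assoc)
  also have "\<dots> = (LINT y|lborel. f y * cnj (gaussian_smoothing \<epsilon> f y))"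
    by (rule fourier_pairing_damped[OF f f \<epsilon>])
  finally have "norm (complex_of_real ?A) = norm (LINT y|lborel. f y * cnj (gaussian_smoothing \<epsilon> f y))" by (rule arg_cong)
  moreover have "0 \<le> ?A" by (intro Bochner_Integration.integral_nonneg) simp
  ultimately have "ennreal ?A = ennreal (norm (LINT y|lborel. f y * cnj (gaussian_smoothing \<epsilon> f y)))" by simp
  also have "\<dots> \<le> (\<integral>\<^sup>+y. ennreal (norm (f y * cnj (gaussian_smoothing \<epsilon> f y))) \<partial>lborel)"
    by (rule ennreal_norm_integral_le)
  \<comment> \<open>The outer factor is moved under the average before it is bounded, so that
    exchanging the integrals leaves for each \<open>z\<close> an integral evaluated by
    \<open>inner\<close>.\<close>
  also have "\<dots> \<le> (\<integral>\<^sup>+y. (\<integral>\<^sup>+z. ennreal (((norm (f y))\<^sup>2 + (norm (f (y + \<epsilon> *\<^sub>R z)))\<^sup>2) / 2) * ennreal (gaussian z) \<partial>lborel) \<partial>lborel)"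
  proof (rule nn_integral_mono)
    fix y
    have "ennreal (norm (f y * cnj (gaussian_smoothing \<epsilon> f y)))
        = ennreal (norm (f y)) * ennreal (norm (LINT z|lborel. f (y + \<epsilon> *\<^sub>R z) * complex_of_real (gaussian z)))"
      using \<epsilon> by (simp add: norm_mult ennreal_mult gaussian_smoothing_average)
    also have "\<dots> \<le> ennreal (norm (f y)) * (\<integral>\<^sup>+z. ennreal (norm (f (y + \<epsilon> *\<^sub>R z) * complex_of_real (gaussian z))) \<partial>lborel)"
      by (intro mult_left_mono ennreal_norm_integral_le) simp
    also have "\<dots> = (\<integral>\<^sup>+z. ennreal (norm (f y)) * ennreal (norm (f (y + \<epsilon> *\<^sub>R z) * complex_of_real (gaussian z))) \<partial>lborel)"
      by (intro nn_integral_cmult[symmetric]) measurable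
    also have "\<dots> \<le> (\<integral>\<^sup>+z. ennreal (((norm (f y))\<^sup>2 + (norm (f (y + \<epsilon> *\<^sub>R z)))\<^sup>2) / 2) * ennreal (gaussian z) \<partial>lborel)"
    proof (rule nn_integral_mono)
      fix z :: 'a
      have "norm (f y) * norm (f (y + \<epsilon> *\<^sub>R z)) \<le> ((norm (f y))\<^sup>2 + (norm (f (y + \<epsilon> *\<^sub>R z)))\<^sup>2) / 2"
        using sum_squares_bound[of "norm (f y)" "norm (f (y + \<epsilon> *\<^sub>R z))"] by simp
      then have "norm (f y) * norm (f (y + \<epsilon> *\<^sub>R z)) * gaussian z
          \<le> ((norm (f y))\<^sup>2 + (norm (f (y + \<epsilon> *\<^sub>R z)))\<^sup>2) / 2 * gaussian z"
        by (rule mult_right_mono) simp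
      then show "ennreal (norm (f y)) * ennreal (norm (f (y + \<epsilon> *\<^sub>R z) * complex_of_real (gaussian z)))
          \<le> ennreal (((norm (f y))\<^sup>2 + (norm (f (y + \<epsilon> *\<^sub>R z)))\<^sup>2) / 2) * ennreal (gaussian z)"
        by (simp add: norm_mult mult.assoc flip: ennreal_mult)
    qed
    finally show "ennreal (norm (f y * cnj (gaussian_smoothing \<epsilon> f y)))
      \<le> (\<integral>\<^sup>+z. ennreal (((norm (f y))\<^sup>2 + (norm (f (y + \<epsilon> *\<^sub>R z)))\<^sup>2) / 2) * ennreal (gaussian z) \<partial>lborel)" .
  qed
  also have "\<dots> = (\<integral>\<^sup>+z. (\<integral>\<^sup>+y. ennreal (((norm (f y))\<^sup>2 + (norm (f (y + \<epsilon> *\<^sub>R z)))\<^sup>2) / 2) * ennreal (gaussian z) \<partial>lborel) \<partial>lborel)"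
    by (rule lborel_pair.Fubini') measurable
  also have "\<dots> = (\<integral>\<^sup>+z. ennreal ?I * ennreal (gaussian (z::'a)) \<partial>lborel)"
    by (intro nn_integral_cong) (simp add: nn_integral_multc inner)
  also have "\<dots> = ennreal ?I" by (simp add: nn_integral_cmult nn_integral_gaussian)
  finally show "?A \<le> ?I" by (simp add: ennreal_le_iff)
qed

text \<open>Removing the damping calls for Fatou's lemma: integrability of the limit is part of the
  claim, so no majorant is available yet.\<close>

lemma fourier_bessel:
  fixes f :: "'a::euclidean_space \<Rightarrow> complex"
  assumes f: "integrable lborel f" and f2: "integrable lborel (\<lambda>x. (norm (f x))\<^sup>2)"
  shows "integrable lborel (\<lambda>l. (norm (fourier f l))\<^sup>2)"
    and "(LINT l|lborel. (norm (fourier f l))\<^sup>2) \<le> (LINT x|lborel. (norm (f x))\<^sup>2)"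
proof -
  note [measurable] = borel_measurable_integrable[OF f]
  let ?I = "LINT x|lborel. (norm (f x))\<^sup>2"
  let ?u = "\<lambda>n l. ennreal ((norm (fourier f l))\<^sup>2 * gaussian (width n *\<^sub>R l))"
  have "(\<lambda>n. ?u n l) \<longlonglongrightarrow> ennreal ((norm (fourier f l))\<^sup>2 * 1)" for l
    by (intro tendsto_ennrealI tendsto_intros gaussian_width_tendsto)
  then have "liminf (\<lambda>n. ?u n l) = ennreal ((norm (fourier f l))\<^sup>2)" for l
    using lim_imp_Liminf[OF trivial_limit_sequentially, of "\<lambda>n. ?u n l"] by simp
  then have "(\<integral>\<^sup>+l. ennreal ((norm (fourier f l))\<^sup>2) \<partial>lborel) = (\<integral>\<^sup>+l. liminf (\<lambda>n. ?u n l) \<partial>lborel)" by simp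
  also have "\<dots> \<le> liminf (\<lambda>n. \<integral>\<^sup>+l. ?u n l \<partial>lborel)"
    by (rule nn_integral_liminf) measurable
  also have "\<dots> \<le> liminf (\<lambda>n::nat. ennreal ?I)"
  proof (intro Liminf_mono always_eventually allI)
    fix n
    have "(\<integral>\<^sup>+l. ?u n l \<partial>lborel) = ennreal (LINT l|lborel. (norm (fourier f l))\<^sup>2 * gaussian (width n *\<^sub>R l))"
      by (intro nn_integral_eq_integral damped_bessel(1)[OF f f2]) auto
    then show "(\<integral>\<^sup>+l. ?u n l \<partial>lborel) \<le> ennreal ?I"
      using damped_bessel(2)[OF f f2, of "width n"] by (simp add: ennreal_leI)
  qed
  finally have le: "(\<integral>\<^sup>+l. ennreal ((norm (fourier f l))\<^sup>2) \<partial>lborel) \<le> ennreal ?I"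
    by (simp add: Liminf_const)
  show int: "integrable lborel (\<lambda>l. (norm (fourier f l))\<^sup>2)"
    using le by (intro integrableI_bounded) (auto simp: less_top[symmetric] top_unique)
  show "(LINT l|lborel. (norm (fourier f l))\<^sup>2) \<le> ?I"
    using le by (subst (asm) nn_integral_eq_integral[OF int]) (auto simp: ennreal_le_iff)
qed

text \<open>With \<open>\<psi> = f\<close> this would be the missing half of Plancherel. Keeping
  \<open>\<psi>\<close> continuous and bounded lets the damping be removed on the left; on the
  right, Bessel's inequality for \<open>\<psi>\<close> replaces the square integral of its
  transform.\<close>

lemma fourier_polarization_bound:
  fixes f \<psi> :: "'a::euclidean_space \<Rightarrow> complex"
  assumes f: "integrable lborel f" and f2: "integrable lborel (\<lambda>x. (norm (f x))\<^sup>2)"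
    and cont: "continuous_on UNIV \<psi>" and bound: "\<And>x. norm (\<psi> x) \<le> C"
    and \<psi>: "integrable lborel \<psi>" and \<psi>2: "integrable lborel (\<lambda>x. (norm (\<psi> x))\<^sup>2)"
  shows "2 * Re (LINT x|lborel. f x * cnj (\<psi> x))
    \<le> (LINT l|lborel. (norm (fourier f l))\<^sup>2) + (LINT x|lborel. (norm (\<psi> x))\<^sup>2)"
proof (rule LIMSEQ_le_const2)
  have cnj: "gaussian_smoothing \<epsilon> (\<lambda>x. cnj (\<psi> x)) x = cnj (gaussian_smoothing \<epsilon> \<psi> x)" for \<epsilon> x
    unfolding gaussian_smoothing_def Bochner_Integration.integral_cnj[symmetric] by (simp del: Bochner_Integration.integral_cnj)
  have "(\<lambda>n. LINT x|lborel. f x * gaussian_smoothing (width n) (\<lambda>x. cnj (\<psi> x)) x) \<longlonglongrightarrow> (LINT x|lborel. f x * cnj (\<psi> x))"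
    by (rule gaussian_smoothing_pairing_tendsto[OF f, where C=C]) (auto intro!: continuous_intros cont bound)
  then show "(\<lambda>n. 2 * Re (LINT x|lborel. f x * cnj (gaussian_smoothing (width n) \<psi> x))) \<longlonglongrightarrow> 2 * Re (LINT x|lborel. f x * cnj (\<psi> x))"
    unfolding cnj by (intro tendsto_intros)
  have "2 * Re (LINT x|lborel. f x * cnj (gaussian_smoothing (width n) \<psi> x))
    \<le> (LINT l|lborel. (norm (fourier f l))\<^sup>2) + (LINT x|lborel. (norm (\<psi> x))\<^sup>2)" for n
  proof -
    note [measurable] = borel_measurable_integrable[OF f] borel_measurable_integrable[OF \<psi>]
    let ?p = "\<lambda>l. fourier f l * (cnj (fourier \<psi> l) * complex_of_real (gaussian (width n *\<^sub>R l)))"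
    note bf = fourier_bessel[OF f f2] and b\<psi> = fourier_bessel[OF \<psi> \<psi>2]
    have ptw: "2 * norm (?p l) \<le> (norm (fourier f l))\<^sup>2 + (norm (fourier \<psi> l))\<^sup>2" for l
    proof -
      have "norm (?p l) = norm (fourier f l) * norm (fourier \<psi> l) * gaussian (width n *\<^sub>R l)"
        by (simp add: norm_mult)
      also have "\<dots> \<le> norm (fourier f l) * norm (fourier \<psi> l) * 1"
        by (intro mult_left_mono gaussian_le_one) simp
      finally show ?thesis using sum_squares_bound[of "norm (fourier f l)" "norm (fourier \<psi> l)"] by simp
    qed
    have int: "integrable lborel ?p"
    proof (rule Bochner_Integration.integrable_bound)
      show "integrable lborel (\<lambda>l. (norm (fourier f l))\<^sup>2 + (norm (fourier \<psi> l))\<^sup>2)"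
        using bf(1) b\<psi>(1) by simp
      show "AE l in lborel. norm (?p l) \<le> norm ((norm (fourier f l))\<^sup>2 + (norm (fourier \<psi> l))\<^sup>2)"
      proof (intro AE_I2)
        fix l show "norm (?p l) \<le> norm ((norm (fourier f l))\<^sup>2 + (norm (fourier \<psi> l))\<^sup>2)"
          unfolding real_norm_def using ptw[of l] norm_ge_zero[of "?p l"] by linarith
      qed
    qed measurable
    have "2 * Re (LINT x|lborel. f x * cnj (gaussian_smoothing (width n) \<psi> x)) = 2 * Re (LINT l|lborel. ?p l)"
      using fourier_pairing_damped[OF f \<psi>, of "width n"] by simp
    also have "\<dots> \<le> 2 * (LINT l|lborel. norm (?p l))"
      by (intro mult_left_mono order_trans[OF complex_Re_le_cmod integral_norm_bound]) simp
    also have "\<dots> = (LINT l|lborel. 2 * norm (?p l))" by simp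
    also have "\<dots> \<le> (LINT l|lborel. (norm (fourier f l))\<^sup>2 + (norm (fourier \<psi> l))\<^sup>2)"
      using int bf(1) b\<psi>(1) ptw by (intro integral_mono) auto
    also have "\<dots> = (LINT l|lborel. (norm (fourier f l))\<^sup>2) + (LINT l|lborel. (norm (fourier \<psi> l))\<^sup>2)"
      using bf(1) b\<psi>(1) by simp
    finally show ?thesis using b\<psi>(2) by simp
  qed
  then show "\<exists>N. \<forall>n\<ge>N. 2 * Re (LINT x|lborel. f x * cnj (gaussian_smoothing (width n) \<psi> x))
    \<le> (LINT l|lborel. (norm (fourier f l))\<^sup>2) + (LINT x|lborel. (norm (\<psi> x))\<^sup>2)" by blast
qed

text \<open>The missing inequality comes from \<open>2 Re \<langle>f, \<psi>\<rangle> \<le> \<parallel>fourier f\<parallel>\<^sup>2 + \<parallel>\<psi>\<parallel>\<^sup>2\<close>, letting \<open>\<psi>\<close> tend first to the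
  truncation \<open>F N\<close> of \<open>f\<close> and then to \<open>f\<close>.\<close>

theorem fourier_plancherel:
  fixes f :: "'a::euclidean_space \<Rightarrow> complex"
  assumes f: "integrable lborel f" and f2: "integrable lborel (\<lambda>x. (norm (f x))\<^sup>2)"
  shows "(LINT l|lborel. (norm (fourier f l))\<^sup>2) = (LINT x|lborel. (norm (f x))\<^sup>2)"
proof (rule antisym[OF fourier_bessel(2)[OF f f2]])
  note [measurable] = borel_measurable_integrable[OF f]
  let ?P = "LINT l|lborel. (norm (fourier f l))\<^sup>2"
  \<comment> \<open>A truncation level that is continuous, bounded and square integrable, hence
    usable as a majorant, yet eventually exceeds \<open>norm (f x)\<close> at every point because
    the Gaussian never vanishes.\<close>
  define B where "B N x = real (Suc N) * gaussian x" for N and x :: 'a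
  define F where "F N x = (if norm (f x) \<le> B N x then f x else 0)" for N x
  have [measurable]: "B N \<in> borel_measurable borel" for N unfolding B_def by measurable
  have [measurable]: "F N \<in> borel_measurable borel" for N unfolding F_def by measurable
  have B: "continuous_on UNIV (B N)" "\<And>x. 0 < B N x" "integrable lborel (B N)" for N
    unfolding B_def by (auto intro!: continuous_intros continuous_on_gaussian mult_pos_pos gaussian_pos integrable_gaussian)
  have B_le: "B N x \<le> real (Suc N)" for N x
    using mult_left_mono[OF gaussian_le_one[of x], of "real (Suc N)"] by (simp add: B_def)
  have B2: "integrable lborel (\<lambda>x. (B N x)\<^sup>2)" for N
  proof (rule Bochner_Integration.integrable_bound[where f="\<lambda>x. real (Suc N) * B N x"])
    show "AE x in lborel. norm ((B N x)\<^sup>2) \<le> norm (real (Suc N) * B N x)"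
    proof (intro AE_I2)
      fix x
      show "norm ((B N x)\<^sup>2) \<le> norm (real (Suc N) * B N x)"
        using mult_right_mono[OF B_le[of N x], of "B N x"] B(2)[of N x] by (simp add: power2_eq_square)
    qed
  qed (use B(3) in auto)
  have truncated: "(LINT x|lborel. (norm (F N x))\<^sup>2) \<le> ?P" for N
  proof -
    obtain g where g: "\<And>n::nat. continuous_on UNIV (g n)" "\<And>n x. norm (g n x) \<le> B N x"
      and lim: "AE x in lborel. (\<lambda>n. g n x) \<longlonglongrightarrow> F N x"
    proof (rule continuous_approximation[of "F N" "B N"])
      show "norm (F N x) \<le> B N x" for x using B(2)[of N x] by (simp add: F_def less_imp_le)
    qed (use B in auto)
    have [measurable]: "g n \<in> borel_measurable borel" for n by (rule borel_measurable_continuous_onI[OF g(1)])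
    have g_sq: "(norm (g n x))\<^sup>2 \<le> (B N x)\<^sup>2" for n x by (intro power_mono g(2)) simp
    have g_int: "integrable lborel (g n)" for n
      by (rule Bochner_Integration.integrable_bound[OF B(3)[of N]]) (use g(2) B(2) in \<open>auto simp: less_imp_le\<close>)
    have g2_int: "integrable lborel (\<lambda>x. (norm (g n x))\<^sup>2)" for n
      by (rule Bochner_Integration.integrable_bound[OF B2[of N]]) (use g_sq in auto)
    have g_le: "norm (g n x) \<le> real (Suc N)" for n x using g(2) B_le order_trans by blast
    have 1: "2 * Re (LINT x|lborel. f x * cnj (g n x)) \<le> ?P + (LINT x|lborel. (norm (g n x))\<^sup>2)" for n
      by (rule fourier_polarization_bound[OF f f2 g(1) g_le g_int g2_int])
    have 2: "(\<lambda>n. LINT x|lborel. f x * cnj (g n x)) \<longlonglongrightarrow> (LINT x|lborel. f x * cnj (F N x))"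
    proof (rule integral_dominated_convergence[where w="\<lambda>x. norm (f x) * real (Suc N)"])
      show "AE x in lborel. (\<lambda>n. f x * cnj (g n x)) \<longlonglongrightarrow> f x * cnj (F N x)"
        using lim by eventually_elim (intro tendsto_intros)
      show "AE x in lborel. norm (f x * cnj (g n x)) \<le> norm (f x) * real (Suc N)" for n
        unfolding norm_mult complex_mod_cnj by (intro AE_I2 mult_left_mono g_le norm_ge_zero)
    qed (use f in auto)
    have 3: "(\<lambda>n. LINT x|lborel. (norm (g n x))\<^sup>2) \<longlonglongrightarrow> (LINT x|lborel. (norm (F N x))\<^sup>2)"
    proof (rule integral_dominated_convergence[where w="\<lambda>x. (B N x)\<^sup>2"])
      show "AE x in lborel. (\<lambda>n. (norm (g n x))\<^sup>2) \<longlonglongrightarrow> (norm (F N x))\<^sup>2"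
        using lim by eventually_elim (intro tendsto_intros)
    qed (use B2 g_sq in auto)
    have "2 * Re (LINT x|lborel. f x * cnj (F N x)) \<le> ?P + (LINT x|lborel. (norm (F N x))\<^sup>2)"
      by (rule LIMSEQ_le[OF tendsto_mult[OF tendsto_const tendsto_Re[OF 2]] tendsto_add[OF tendsto_const 3]]) (use 1 in blast)
    \<comment> \<open>Because \<open>F N x\<close> is \<open>f x\<close> or 0, the doubled pairing
      is twice the square integral of \<open>F N\<close>; subtracting one copy leaves the
      claim.\<close>
    moreover have "f x * cnj (F N x) = complex_of_real ((norm (F N x))\<^sup>2)" for x
      by (simp add: F_def complex_norm_square del: of_real_power)
    ultimately show ?thesis by (simp only: integral_complex_of_real Re_complex_of_real)
  qed
  have "(\<lambda>N. LINT x|lborel. (norm (F N x))\<^sup>2) \<longlonglongrightarrow> (LINT x|lborel. (norm (f x))\<^sup>2)"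
  proof (rule integral_dominated_convergence[where w="\<lambda>x. (norm (f x))\<^sup>2"])
    show "AE x in lborel. (\<lambda>N. (norm (F N x))\<^sup>2) \<longlonglongrightarrow> (norm (f x))\<^sup>2"
    proof (intro AE_I2 tendsto_eventually)
      fix x
      obtain n :: nat where n: "norm (f x) / gaussian x \<le> real n" using real_arch_simple by blast
      have "F N x = f x" if "n \<le> N" for N
      proof -
        have "norm (f x) \<le> real n * gaussian x" using n gaussian_pos[of x] by (simp add: pos_divide_le_eq)
        also have "\<dots> \<le> B N x" unfolding B_def using that by (intro mult_right_mono) auto
        finally show ?thesis by (simp add: F_def)
      qed
      then show "\<forall>\<^sub>F N in sequentially. (norm (F N x))\<^sup>2 = (norm (f x))\<^sup>2"
        unfolding eventually_sequentially by (intro exI[of _ n]) simp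
    qed
    show "AE x in lborel. norm ((norm (F N x))\<^sup>2) \<le> (norm (f x))\<^sup>2" for N
      by (intro AE_I2) (simp add: F_def)
  qed (use f2 in auto)
  then show "(LINT x|lborel. (norm (f x))\<^sup>2) \<le> ?P"
    by (rule LIMSEQ_le_const2) (use truncated in blast)
qed

subsection \<open>Transforms on the dominant chamber\<close>

text \<open>The bridge to the Borel theory: a representative differing on a null set, built
  separately for the real and imaginary parts.\<close>

lemma lebesgue_integrable_borel_version:
  fixes f :: "'a::euclidean_space \<Rightarrow> complex"
  assumes f: "integrable lebesgue f"
  obtains f' where "integrable lborel f'" "AE x in lebesgue. f x = f' x"
proof -
  note [measurable] = borel_measurable_integrable[OF f]
  have Re: "(\<lambda>x. Re (f x)) \<in> borel_measurable lebesgue" and Im: "(\<lambda>x. Im (f x)) \<in> borel_measurable lebesgue"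
    by measurable
  obtain u where u: "u \<in> borel_measurable lborel" "AE x in lborel. Re (f x) = u x"
    using completion_ex_borel_measurable_real[OF Re] by blast
  obtain v where v: "v \<in> borel_measurable lborel" "AE x in lborel. Im (f x) = v x"
    using completion_ex_borel_measurable_real[OF Im] by blast
  note [measurable] = u(1) v(1)
  define f' where "f' x = complex_of_real (u x) + \<i> * complex_of_real (v x)" for x
  have f'[measurable]: "f' \<in> borel_measurable lborel" unfolding f'_def by measurable
  have "AE x in lborel. f x = f' x"
    using u(2) v(2) by eventually_elim (simp add: f'_def complex_eq_iff)
  then have ae: "AE x in lebesgue. f x = f' x" by (rule AE_completion)
  have "integrable lebesgue f'"
    by (rule integrable_cong_AE_imp[OF f measurable_completion[OF f']]) (use ae in auto)
  then have "integrable lborel f'" using integrable_completion[OF f'] by simp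
  then show ?thesis using ae by (rule that)
qed

text \<open>Continuity at the single point \<open>x\<close> spreads a disagreement there to a
  nonempty open set, which cannot be null.\<close>

lemma AE_eq_isCont_imp_eq:
  fixes f g :: "'a::euclidean_space \<Rightarrow> 'b::real_normed_vector"
  assumes ae: "AE x in lebesgue. f x = g x" and f: "isCont f x" and g: "isCont g x"
  shows "f x = g x"
proof (rule ccontr)
  assume "f x \<noteq> g x"
  then have "f x - g x \<in> - {0}" by simp
  moreover have "isCont (\<lambda>y. f y - g y) x" using f g by (intro continuous_intros)
  ultimately obtain U where U: "open U" "x \<in> U" "\<And>y. y \<in> U \<Longrightarrow> f y - g y \<in> - {0}"
    unfolding continuous_at_open by (metis open_delete open_UNIV Compl_eq_Diff_UNIV)
  obtain N where N: "\<And>y. y \<in> space lebesgue - N \<Longrightarrow> f y = g y" "N \<in> null_sets lebesgue"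
    using AE_E3[OF ae] by blast
  have "U \<subseteq> N"
  proof
    fix y assume "y \<in> U"
    then have "f y \<noteq> g y" using U(3) by force
    then show "y \<in> N" using N(1)[of y] by auto
  qed
  then have "negligible U" using N(2) negligible_subset by (auto simp: negligible_iff_null_sets)
  then show False using open_not_negligible[OF U(1)] U(2) by auto
qed

lemma exp_eq_character: "exp (2 * complex_of_real pi * \<i> * complex_of_real t) = character t"
  by (simp add: character_def cis_conv_exp mult_ac)

lemma exp_minus_eq_character: "exp (- (2 * complex_of_real pi * \<i> * complex_of_real t)) = character (- t)"
  using exp_eq_character[of "- t"] by simp

lemma character_lebesgue_measurable [measurable]: "(\<lambda>x. character (l \<bullet> x)) \<in> borel_measurable lebesgue"
  by (intro measurable_completion) measurable

lemma integrable_lebesgue_mult_character: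
  fixes f :: "'a::euclidean_space \<Rightarrow> complex"
  assumes f: "integrable lebesgue f"
  shows "integrable lebesgue (\<lambda>x. f x * character (l \<bullet> x))"
proof -
  note [measurable] = borel_measurable_integrable[OF f]
  show ?thesis by (rule Bochner_Integration.integrable_bound[OF f]) (auto simp: norm_mult)
qed

lemma fourier_transform_eq_fourier:
  assumes f: "integrable lebesgue f" and f': "integrable lborel f'" and ae: "AE x in lebesgue. f x = f' x"
  shows "fourier_transform f = fourier f'"
proof
  fix l
  note [measurable] = borel_measurable_integrable[OF f] borel_measurable_integrable[OF f']
  have m: "(\<lambda>x. f' x * character (l \<bullet> x)) \<in> borel_measurable lborel" by measurable
  have "fourier_transform f l = (LINT x|lebesgue. f x * character (l \<bullet> x))"
    by (simp add: fourier_transform_def exp_eq_character)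
  also have "\<dots> = (LINT x|lebesgue. f' x * character (l \<bullet> x))"
  proof (rule integral_cong_AE)
    show "(\<lambda>x. f' x * character (l \<bullet> x)) \<in> borel_measurable lebesgue"
      by (rule measurable_completion[OF m])
    show "AE x in lebesgue. f x * character (l \<bullet> x) = f' x * character (l \<bullet> x)"
      using ae by eventually_elim simp
  qed measurable
  also have "\<dots> = fourier f' l" unfolding fourier_def by (rule integral_completion[OF m])
  finally show "fourier_transform f l = fourier f' l" .
qed

lemma inverse_fourier_transform_eq_fourier:
  assumes "g \<in> borel_measurable borel"
  shows "inverse_fourier_transform g x = fourier g (- x)"
proof -
  note [measurable] = assms
  have m: "(\<lambda>l. g l * character (- (l \<bullet> x))) \<in> borel_measurable lborel" by measurable
  show ?thesis
    unfolding inverse_fourier_transform_def exp_minus_eq_character integral_completion[OF m]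
    by (simp add: fourier_def inner_commute)
qed

text \<open>Substituting \<open>w x\<close> for \<open>x\<close> in the integral at
  \<open>w l\<close> cancels \<open>w\<close> in the inner product, as \<open>w\<close> is
  orthogonal.\<close>

lemma fourier_transform_weyl_invariant:
  assumes w: "w \<in> weyl_group \<alpha>" and f: "integrable lebesgue f"
    and inv: "\<And>x. f (w x) = f x"
  shows "fourier_transform f (w l) = fourier_transform f l"
  using integral_lebesgue_orthogonal[OF orthogonal_transformation_weyl_group[OF w] integrable_lebesgue_mult_character[OF f, of "w l"]]
  by (simp add: fourier_transform_def exp_eq_character inv inner_weyl_group[OF w])

text \<open>Integrability of \<open>f\<close> makes the transform an absolutely convergent integral.
  Inversion is stated under integrability of the transform, almost everywhere and at points of
  continuity, since the transform does not see changes of \<open>f\<close> on null sets. The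
  Plancherel clause also asserts square integrability of the transform, so that its right-hand side
  is a genuine integral and not a default value.\<close>

theorem mainTheorem5:
  fixes R :: "(real ^ 'n) set"
    and \<alpha> :: "'n \<Rightarrow> real ^ 'n"
    and f :: "real ^ 'n \<Rightarrow> complex"
  assumes R: "root_system R"
    and \<alpha>: "simple_roots R \<alpha>"
    and f_integrable: "integrable lebesgue f"
    and f_invariant: "\<And>w x. w \<in> weyl_group \<alpha> \<Longrightarrow> f (w x) = f x"
  shows "(\<forall>w\<in>weyl_group \<alpha>. \<forall>l. fourier_transform f (w l) = fourier_transform f l) \<and>
    (\<forall>l. fourier_transform f l =
           (LINT x:dominant_chamber \<alpha>|lebesgue. f x * modified_orbit_function \<alpha> l x)) \<and>
    (integrable lebesgue (fourier_transform f) \<longrightarrow>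
           (\<forall>x. inverse_fourier_transform (fourier_transform f) x =
              (LINT l:dominant_chamber \<alpha>|lebesgue.
                 fourier_transform f l * cnj (modified_orbit_function \<alpha> l x))) \<and>
           (AE x in lebesgue. f x =
              (LINT l:dominant_chamber \<alpha>|lebesgue.
                 fourier_transform f l * cnj (modified_orbit_function \<alpha> l x))) \<and>
           (\<forall>x. isCont f x \<longrightarrow> f x =
              (LINT l:dominant_chamber \<alpha>|lebesgue.
                 fourier_transform f l * cnj (modified_orbit_function \<alpha> l x)))) \<and>
    (set_integrable lebesgue (dominant_chamber \<alpha>) (\<lambda>x. (norm (f x))\<^sup>2) \<longrightarrow>
           set_integrable lebesgue (dominant_chamber \<alpha>) (\<lambda>l. (norm (fourier_transform f l))\<^sup>2) \<and>
           (LINT x:dominant_chamber \<alpha>|lebesgue. (norm (f x))\<^sup>2) =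
           (LINT l:dominant_chamber \<alpha>|lebesgue. (norm (fourier_transform f l))\<^sup>2))"
proof -
  let ?W = "weyl_group \<alpha>" and ?D = "dominant_chamber \<alpha>" and ?F = "fourier_transform f"
  have F_invariant: "?F (w l) = ?F l" if "w \<in> ?W" for w l
    by (rule fourier_transform_weyl_invariant[OF that f_integrable f_invariant[OF that]])
  obtain f' where f': "integrable lborel f'" and ae: "AE x in lebesgue. f x = f' x"
    using lebesgue_integrable_borel_version[OF f_integrable] .
  note f_measurable [measurable] = borel_measurable_integrable[OF f_integrable]
  note [measurable] = borel_measurable_integrable[OF f']
  \<comment> \<open>Equality holds at every point, since null sets do not affect the integral. The
    representative \<open>f'\<close> need not be invariant, so invariance is used only for
    \<open>f\<close> and \<open>?F\<close>.\<close>
  have F: "?F = fourier f'" by (rule fourier_transform_eq_fourier[OF f_integrable f' ae])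

  have forward: "?F l = (LINT x:?D|lebesgue. f x * modified_orbit_function \<alpha> l x)" for l
  proof -
    have "?F l = (LINT x:?D|lebesgue. f x * (\<Sum>w\<in>?W. character (l \<bullet> w x)))"
      unfolding fourier_transform_def exp_eq_character
      using integral_weyl_chamber_times[OF R \<alpha>, of f "\<lambda>x. character (l \<bullet> x)"]
        integrable_lebesgue_mult_character[OF f_integrable] f_invariant by simp
    \<comment> \<open>Folding lets \<open>w\<close> act on \<open>x\<close>, whereas in the orbit
      function it acts on \<open>l\<close>. Orthogonality moves it across as its inverse, and
      inversion permutes the group; for the inverse transform \<open>w\<close> falls on
      \<open>l\<close> directly.\<close>
    moreover have "(\<Sum>w\<in>?W. character (l \<bullet> w x)) = modified_orbit_function \<alpha> l x" for x
    proof -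
      have "(\<Sum>w\<in>?W. character (l \<bullet> w x)) = (\<Sum>w\<in>?W. character (inv w l \<bullet> x))"
        by (intro sum.cong refl) (simp add: inner_weyl_group_inv)
      also have "\<dots> = (\<Sum>w\<in>?W. character (w l \<bullet> x))"
        by (rule sum.reindex_bij_betw[OF bij_betw_inv_weyl_group])
      finally show ?thesis by (simp add: modified_orbit_function_def exp_eq_character)
    qed
    ultimately show ?thesis by simp
  qed

  have inverse: "inverse_fourier_transform ?F x = (LINT l:?D|lebesgue. ?F l * cnj (modified_orbit_function \<alpha> l x))"
      "inverse_fourier_transform ?F x = fourier (fourier f') (- x)"
    if int: "integrable lebesgue ?F" for x
  proof -
    have "integrable lebesgue (\<lambda>l. ?F l * character (- (l \<bullet> x)))"
      using integrable_lebesgue_mult_character[OF int, of "- x"] by (simp add: inner_commute)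
    then have "inverse_fourier_transform ?F x = (LINT l:?D|lebesgue. ?F l * (\<Sum>w\<in>?W. character (- (w l \<bullet> x))))"
      unfolding inverse_fourier_transform_def exp_minus_eq_character
      using integral_weyl_chamber_times[OF R \<alpha>, of ?F "\<lambda>l. character (- (l \<bullet> x))"] F_invariant by simp
    then show "inverse_fourier_transform ?F x = (LINT l:?D|lebesgue. ?F l * cnj (modified_orbit_function \<alpha> l x))"
      by (simp add: modified_orbit_function_def exp_eq_character)
    show "inverse_fourier_transform ?F x = fourier (fourier f') (- x)"
      unfolding F by (rule inverse_fourier_transform_eq_fourier) measurable
  qed

  have inversion: "AE x in lebesgue. f x = fourier (fourier f') (- x)"
      "\<And>x. isCont f x \<Longrightarrow> f x = fourier (fourier f') (- x)" if int: "integrable lebesgue ?F"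
  proof -
    have int': "integrable lborel (fourier f')"
      using int unfolding F by (subst (asm) integrable_completion) auto
    show inv: "AE x in lebesgue. f x = fourier (fourier f') (- x)"
      using ae AE_completion[OF fourier_inversion_AE[OF f' int']] by eventually_elim simp
    \<comment> \<open>The right-hand side is a transform of an integrable function and so
      continuous, which leaves continuity of \<open>f\<close> at \<open>x\<close> as the only
      further condition.\<close>
    show "f x = fourier (fourier f') (- x)" if "isCont f x" for x
    proof (rule AE_eq_isCont_imp_eq[OF inv that])
      show "isCont (\<lambda>x. fourier (fourier f') (- x)) x"
        by (rule isCont_o2[where g="fourier (fourier f')"]) (auto intro: isCont_fourier[OF int'])
    qed
  qed

  have plancherel: "set_integrable lebesgue ?D (\<lambda>l. (norm (?F l))\<^sup>2)"
      "(LINT x:?D|lebesgue. (norm (f x))\<^sup>2) = (LINT l:?D|lebesgue. (norm (?F l))\<^sup>2)"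
    if sq: "set_integrable lebesgue ?D (\<lambda>x. (norm (f x))\<^sup>2)"
  proof -
    have sq_int: "integrable lebesgue (\<lambda>x. (norm (f x))\<^sup>2)"
      by (rule integrable_weyl_invariant[OF R \<alpha> _ _ sq]) (simp_all add: f_invariant)
    have ae_sq: "AE x in lebesgue. (norm (f x))\<^sup>2 = (norm (f' x))\<^sup>2"
      using ae by eventually_elim simp
    have m: "(\<lambda>x. (norm (f' x))\<^sup>2) \<in> borel_measurable lborel" by measurable
    note m' = measurable_completion[OF m]
    have "integrable lebesgue (\<lambda>x. (norm (f' x))\<^sup>2)"
      by (rule integrable_cong_AE_imp[OF sq_int m']) (use ae_sq in auto)
    then have sq': "integrable lborel (\<lambda>x. (norm (f' x))\<^sup>2)" using integrable_completion[OF m] by simp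
    have mF: "(\<lambda>l. (norm (?F l))\<^sup>2) \<in> borel_measurable lborel" unfolding F by measurable
    have F_int: "integrable lebesgue (\<lambda>l. (norm (?F l))\<^sup>2)"
      using fourier_bessel(1)[OF f' sq', folded F] integrable_completion[OF mF] by simp
    show "set_integrable lebesgue ?D (\<lambda>l. (norm (?F l))\<^sup>2)"
      using integral_weyl_chambers(1)[OF R \<alpha> F_int weyl_group.id] by simp
    have "(LINT x|lebesgue. (norm (f x))\<^sup>2) = (LINT x|lebesgue. (norm (f' x))\<^sup>2)"
      by (rule integral_cong_AE[OF _ m' ae_sq]) measurable
    also have "\<dots> = (LINT x|lborel. (norm (f' x))\<^sup>2)" by (rule integral_completion[OF m])
    also have "\<dots> = (LINT l|lborel. (norm (?F l))\<^sup>2)"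
      unfolding F by (rule fourier_plancherel[OF f' sq', symmetric])
    also have "\<dots> = (LINT l|lebesgue. (norm (?F l))\<^sup>2)" by (rule integral_completion[OF mF, symmetric])
    \<comment> \<open>Each whole-space square integral of an invariant function is the group order
      times its chamber integral; the order is nonzero and cancels.\<close>
    finally have "real (card ?W) *\<^sub>R (LINT x:?D|lebesgue. (norm (f x))\<^sup>2)
        = real (card ?W) *\<^sub>R (LINT l:?D|lebesgue. (norm (?F l))\<^sup>2)"
      by (simp only: integral_weyl_invariant[OF R \<alpha> sq_int] integral_weyl_invariant[OF R \<alpha> F_int] f_invariant F_invariant)
    moreover have "card ?W \<noteq> 0"
      using finite_weyl_group[OF R \<alpha>] weyl_group.id[of \<alpha>] by auto
    ultimately show "(LINT x:?D|lebesgue. (norm (f x))\<^sup>2) = (LINT l:?D|lebesgue. (norm (?F l))\<^sup>2)" by simp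
  qed

  show ?thesis
    using F_invariant forward inverse inversion plancherel by auto
qed

end
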